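(* Let $T=(T_1,T_2)$ and $X=(X_1,X_2)$ be independent bivariate Lévy processes, where $T$ is a subordinator. Suppose neither $T_1\equiv0$ nor $T_2\equiv0$. If $X\circ T$ is also a Lévy process, then $T_1=T_2$ must be indistinguishable, provided one of the following holds in addition: (i) $X\overset{D}{=}-X$ is symmetric, and $X_1,X_2$ are dependent; (ii) $T$ is deterministic, and $X_1,X_2$ are dependent; (iii) $T$ admits a finite first moment, and $X$ admits a finite second moment with correlated components $X_1,X_2$.
   Context: A bivariate subordinator is a bivariate Lévy process with nondecreasing components. $(X\circ T)(t)=(X_1(T_1(t)),X_2(T_2(t)))$ for $t\ge0$. $\overset{D}{=}$ denotes equality in law. $T_k\equiv 0$ means that $T_k$ is the null process. Correlated components means $\mathrm{Cov}(X_1(1),X_2(1))\neq0$. Two processes are indistinguishable if almost surely their paths coincide at all times. *)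

theory Defs
  imports "HOL-Probability.Probability"
begin

text \<open>Processes have type \<open>real \<Rightarrow> 'a \<Rightarrow> 'b\<close> (time first, then the sample point). The time
  set is \<open>[0, \<infinity>)\<close>; values at negative times never matter.\<close>

definition cadlag :: "(real \<Rightarrow> 'b::topological_space) \<Rightarrow> bool" where
  "cadlag x \<longleftrightarrow>
     (\<forall>t\<ge>0. (x \<longlongrightarrow> x t) (at_right t)) \<and>
     (\<forall>t>0. \<exists>l. (x \<longlongrightarrow> l) (at_left t))"

text \<open>Stochastic continuity is not listed separately: it follows from right-continuity at
  \<open>0\<close> and stationarity of the increments.\<close>

definition levy_process :: "'a measure \<Rightarrow> (real \<Rightarrow> 'a \<Rightarrow> 'b::euclidean_space) \<Rightarrow> bool" where
  "levy_process M X \<longleftrightarrow>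
     prob_space M \<and>
     (\<forall>t\<ge>0. X t \<in> borel_measurable M) \<and>
     (AE \<omega> in M. X 0 \<omega> = 0) \<and>
     (\<forall>(n::nat) (t::nat \<Rightarrow> real). 0 \<le> t 0 \<and> (\<forall>i<n. t i \<le> t (Suc i)) \<longrightarrow>
        prob_space.indep_vars M (\<lambda>_. borel) (\<lambda>i \<omega>. X (t (Suc i)) \<omega> - X (t i) \<omega>) {..<n}) \<and>
     (\<forall>s t. 0 \<le> s \<and> s \<le> t \<longrightarrow>
        distr M borel (\<lambda>\<omega>. X t \<omega> - X s \<omega>) = distr M borel (X (t - s))) \<and>
     (AE \<omega> in M. cadlag (\<lambda>t. X t \<omega>))"

definition bivariate_subordinator :: "'a measure \<Rightarrow> (real \<Rightarrow> 'a \<Rightarrow> real \<times> real) \<Rightarrow> bool" where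
  "bivariate_subordinator M T \<longleftrightarrow>
     levy_process M T \<and>
     (AE \<omega> in M. \<forall>s t. 0 \<le> s \<and> s \<le> t \<longrightarrow>
        fst (T s \<omega>) \<le> fst (T t \<omega>) \<and> snd (T s \<omega>) \<le> snd (T t \<omega>))"

definition comp1 :: "(real \<Rightarrow> 'a \<Rightarrow> real \<times> real) \<Rightarrow> real \<Rightarrow> 'a \<Rightarrow> real" where
  "comp1 X t \<omega> = fst (X t \<omega>)"

definition comp2 :: "(real \<Rightarrow> 'a \<Rightarrow> real \<times> real) \<Rightarrow> real \<Rightarrow> 'a \<Rightarrow> real" where
  "comp2 X t \<omega> = snd (X t \<omega>)"

definition subordinate ::
  "(real \<Rightarrow> 'a \<Rightarrow> real \<times> real) \<Rightarrow> (real \<Rightarrow> 'a \<Rightarrow> real \<times> real) \<Rightarrow> real \<Rightarrow> 'a \<Rightarrow> real \<times> real" where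
  "subordinate X T t \<omega> = (comp1 X (comp1 T t \<omega>) \<omega>, comp2 X (comp2 T t \<omega>) \<omega>)"

definition indistinguishable ::
  "'a measure \<Rightarrow> (real \<Rightarrow> 'a \<Rightarrow> 'b) \<Rightarrow> (real \<Rightarrow> 'a \<Rightarrow> 'b) \<Rightarrow> bool" where
  "indistinguishable M X Y \<longleftrightarrow> (AE \<omega> in M. \<forall>t\<ge>0. X t \<omega> = Y t \<omega>)"

text \<open>The whole path as one random element of the product space over the time set.
  Independence and equality in law of processes refer to this random element, equivalently to
  all finite-dimensional distributions.\<close>

definition path_of :: "(real \<Rightarrow> 'a \<Rightarrow> 'b) \<Rightarrow> 'a \<Rightarrow> real \<Rightarrow> 'b" where
  "path_of X \<omega> = (\<lambda>t\<in>{0..}. X t \<omega>)"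

abbreviation path_space :: "(real \<Rightarrow> 'b::topological_space) measure" where
  "path_space \<equiv> PiM {0..} (\<lambda>_. borel)"

definition indep_processes ::
  "'a measure \<Rightarrow> (real \<Rightarrow> 'a \<Rightarrow> 'b::topological_space) \<Rightarrow>
   (real \<Rightarrow> 'a \<Rightarrow> 'b) \<Rightarrow> bool" where
  "indep_processes M X Y \<longleftrightarrow>
     prob_space.indep_var M path_space (path_of X) path_space (path_of Y)"

definition eq_in_law ::
  "'a measure \<Rightarrow> (real \<Rightarrow> 'a \<Rightarrow> 'b::topological_space) \<Rightarrow> (real \<Rightarrow> 'a \<Rightarrow> 'b) \<Rightarrow> bool" where
  "eq_in_law M X Y \<longleftrightarrow> distr M path_space (path_of X) = distr M path_space (path_of Y)"

definition deterministic_process :: "'a measure \<Rightarrow> (real \<Rightarrow> 'a \<Rightarrow> 'b) \<Rightarrow> bool" where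
  "deterministic_process M T \<longleftrightarrow> (\<exists>f. indistinguishable M T (\<lambda>t \<omega>. f t))"

definition finite_moment ::
  "'a measure \<Rightarrow> nat \<Rightarrow> (real \<Rightarrow> 'a \<Rightarrow> 'b::real_normed_vector) \<Rightarrow> bool" where
  "finite_moment M k X \<longleftrightarrow> (\<forall>t\<ge>0. integrable M (\<lambda>\<omega>. norm (X t \<omega>) ^ k))"

definition covariance :: "'a measure \<Rightarrow> ('a \<Rightarrow> real) \<Rightarrow> ('a \<Rightarrow> real) \<Rightarrow> real" where
  "covariance M U V =
     (\<integral>\<omega>. (U \<omega> - (\<integral>\<omega>'. U \<omega>' \<partial>M)) * (V \<omega> - (\<integral>\<omega>'. V \<omega>' \<partial>M)) \<partial>M)"

end

theory Submission
  imports Defs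
begin

text \<open>
  Write \<open>\<psi>\<close> for the characteristic exponent of \<open>X\<close>, so that the characteristic function of
  \<open>X t\<close> at \<open>u\<close> is \<open>exp (t * \<psi> u)\<close>, and \<open>Y = X \<circ> T\<close>. The consequence of \<open>Y\<close> being a Levy
  process that drives the proof is this: for \<open>s \<le> t\<close> the variable \<open>Y\<^sub>1(s)\<close> is independent of
  \<open>Y\<^sub>2(t) - Y\<^sub>2(s)\<close>. Conditionally on \<open>T\<close>, the first variable consumes the increments of \<open>X\<^sub>1\<close>
  over the interval \<open>[0, T\<^sub>1(s)]\<close> and the second one those of \<open>X\<^sub>2\<close> over \<open>[T\<^sub>2(s), T\<^sub>2(t)]\<close>.
  If \<open>\<ell>\<close> denotes the length of the intersection of these intervals, the joint characteristic
  function at \<open>(a, b)\<close> is the expectation of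
  \<open>exp (\<ell> \<psi>(a,b) + (T\<^sub>1(s) - \<ell>) \<psi>(a,0) + (T\<^sub>2(t) - T\<^sub>2(s) - \<ell>) \<psi>(0,b))\<close>, whereas the product
  of the marginal ones, because \<open>T\<close> itself has independent increments, is the expectation of
  \<open>exp (T\<^sub>1(s) \<psi>(a,0) + (T\<^sub>2(t) - T\<^sub>2(s)) \<psi>(0,b))\<close>. Subtracting (\<open>expectation_defect_eq_0\<close>),

  \<open>E [(exp (\<ell> \<psi>(a,b)) - exp (\<ell> (\<psi>(a,0) + \<psi>(0,b)))) * exp (\<dots>)] = 0\<close>   for all \<open>a\<close>, \<open>b\<close>.

  Each of the three hypotheses turns this identity into \<open>\<ell> = 0\<close> almost surely, at least for some
  \<open>t > s\<close>. In the first two, dependence of \<open>X\<^sub>1\<close> and \<open>X\<^sub>2\<close> supplies \<open>(a, b)\<close> with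
  \<open>\<psi>(a,b) \<noteq> \<psi>(a,0) + \<psi>(0,b)\<close> (\<open>indep_comps_if_exponent_additive\<close>).
  If \<open>X\<close> is symmetric, \<open>\<psi>\<close> is real, and the integrand has a constant sign
  and vanishes only where \<open>\<ell> = 0\<close>. If \<open>T\<close> is deterministic, the integrand is a constant, so
  \<open>exp (\<ell> (\<psi>(a,b) - \<psi>(a,0) - \<psi>(0,b))) = 1\<close>; for \<open>t\<close> close to \<open>s\<close> the exponent is too small to be a
  nonzero multiple of \<open>2\<pi>\<i>\<close>. In the case of finite moments put \<open>a = b = h\<close>, divide by \<open>h\<^sup>2\<close> and let
  \<open>h\<close> tend to \<open>0\<close>: the integrand converges to \<open>- c * \<ell>\<close>, where \<open>c\<close> is the covariance, and is dominated
  by a multiple of \<open>\<ell> \<le> T\<^sub>1(s)\<close>, whence \<open>E \<ell> = 0\<close>.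

  Finally \<open>\<ell> = 0\<close> means that \<open>T\<^sub>1(s) \<le> T\<^sub>2(s)\<close> or \<open>T\<^sub>2(t) = T\<^sub>2(s)\<close>. The second event is independent of
  \<open>T(s)\<close>, and it is not almost sure, as otherwise \<open>T\<^sub>2\<close> would be null; hence
  \<open>T\<^sub>1(s) \<le> T\<^sub>2(s)\<close> almost surely (\<open>comp1_le_comp2_if_no_overlap\<close>). Exchanging the components
  gives equality for each fixed \<open>s\<close>, and right-continuity upgrades it to indistinguishability.
\<close>

section \<open>Multiplicative functions on the half-line\<close>

text \<open>The classical smoothing argument for Cauchy's functional equation: continuity makes the
  primitive \<open>G\<close> of \<open>g\<close> nonzero at some \<open>d > 0\<close>, and \<open>g t * G d = G (t + d) - G t\<close> exhibits \<open>g\<close> as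
  differentiable, with \<open>g' = z g\<close>. This replaces the choice of a branch of the logarithm.\<close>

lemma multiplicative_semigroup_eq_exp:
  fixes g :: "real \<Rightarrow> complex"
  assumes mult: "\<And>s t. 0 \<le> s \<Longrightarrow> 0 \<le> t \<Longrightarrow> g (s + t) = g s * g t"
    and bound: "\<And>t. 0 \<le> t \<Longrightarrow> norm (g t) \<le> 1"
    and lim: "(g \<longlongrightarrow> 1) (at_right 0)"
    and zero: "g 0 = 1"
  shows "\<exists>z. \<forall>t\<ge>0. g t = exp (of_real t * z)"
proof -
  have diff: "norm (g t - g s) \<le> norm (g (t - s) - 1)" if "0 \<le> s" "s \<le> t" for s t
  proof -
    have "g t - g s = g s * (g (t - s) - 1)"
      using mult[of s "t - s"] that by (simp add: algebra_simps)
    then show ?thesis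
      using bound[of s] that by (simp add: norm_mult mult_left_le_one_le)
  qed
  have cont: "continuous_on {0..} g"
    unfolding continuous_on_iff
  proof (intro ballI allI impI)
    fix x e :: real assume x: "x \<in> {0..}" and "0 < e"
    then have "\<forall>\<^sub>F h in at_right 0. dist (g h) 1 < e"
      using lim by (simp add: tendsto_iff)
    then obtain d where d: "d > 0" "\<And>h. 0 < h \<Longrightarrow> h < d \<Longrightarrow> dist (g h) 1 < e"
      unfolding eventually_at_right_field by auto
    have "dist (g y) (g x) < e" if "y \<in> {0..}" "dist y x < d" for y
    proof (cases "x = y")
      case True
      then show ?thesis using \<open>0 < e\<close> by simp
    next
      case False
      have "norm (g y - g x) \<le> norm (g \<bar>y - x\<bar> - 1)"
        using diff[of x y] diff[of y x] that x
        by (cases "x \<le> y") (auto simp: norm_minus_commute abs_if)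
      also have "\<dots> < e"
        using d(2)[of "\<bar>y - x\<bar>"] that False by (simp add: dist_norm)
      finally show ?thesis by (simp add: dist_norm)
    qed
    then show "\<exists>d>0. \<forall>x'\<in>{0..}. dist x' x < d \<longrightarrow> dist (g x') (g x) < e"
      using d(1) by blast
  qed
  define G where "G t = integral {0..t} g" for t
  have G': "(G has_vector_derivative g t) (at t within {0..b})" if "0 \<le> t" "t \<le> b" for t b
    unfolding G_def using that
    by (intro integral_has_vector_derivative) (auto intro: continuous_on_subset[OF cont])
  have "\<exists>d>0. G d \<noteq> 0"
  proof (rule ccontr)
    assume "\<not> (\<exists>d>0. G d \<noteq> 0)"
    then have "G d = 0" if "d \<in> {0..1}" for d
      using that by (cases "d = 0") (auto simp: G_def)
    then have "((\<lambda>t. 0) has_vector_derivative g 0) (at 0 within {0..1})"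
      using G'[of 0 1] by (auto elim!: has_vector_derivative_transform[rotated 2])
    moreover have "((\<lambda>t. 0) has_vector_derivative 0) (at (0::real) within {0..1})" by simp
    ultimately have "g 0 = 0"
      by (rule vector_derivative_unique_within[rotated])
        (simp add: at_within_Icc_at_right trivial_limit_at_right_real)
    then show False using zero by simp
  qed
  then obtain d where d: "d > 0" "G d \<noteq> 0" by blast
  define z where "z = (g d - 1) / G d"
  have shift: "g t * G d = G (t + d) - G t" if "0 \<le> t" for t
  proof -
    have int: "g integrable_on {a..b}" if "0 \<le> a" for a b
      using that by (intro integrable_continuous_interval continuous_on_subset[OF cont]) auto
    have "G (t + d) - G t = integral {t..t + d} g"
      using Henstock_Kurzweil_Integration.integral_combine[of 0 t "t + d" g] that d int[of 0 "t+d"]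
      by (simp add: G_def algebra_simps)
    also have "\<dots> = integral {0..d} (\<lambda>s. g (s + t))"
      using integral_shift_Icc_real[of 0 d g t]
      by (simp add: o_def add.commute)
    also have "\<dots> = integral {0..d} (\<lambda>s. g s * g t)"
      using mult that by (intro integral_cong) auto
    also have "\<dots> = G d * g t" by (simp add: G_def)
    finally show ?thesis by simp
  qed
  have deriv: "(g has_vector_derivative z * g t) (at t within {0..b})" if "0 \<le> t" "t \<le> b" for t b
  proof -
    have 1: "((\<lambda>t. G (t + d)) has_vector_derivative g (t + d)) (at t within {0..b})"
    proof -
      have "(G has_vector_derivative g (t + d)) (at (t + d) within {0..b + d})"
        using G'[of "t + d" "b + d"] that d by simp
      then have "(G has_vector_derivative g (t + d)) (at (t + d) within (\<lambda>t. t + d) ` {0..b})"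
        by (rule has_vector_derivative_within_subset) (use d in auto)
      moreover have "((\<lambda>t. t + d) has_vector_derivative 1) (at t within {0..b})"
        by (auto intro!: derivative_eq_intros)
      ultimately show ?thesis
        using vector_diff_chain_within[of "\<lambda>t. t + d" 1 t "{0..b}" G "g (t + d)"]
        by (simp add: o_def add.commute)
    qed
    have "((\<lambda>t. (G (t + d) - G t) / G d) has_vector_derivative (g (t + d) - g t) / G d)
        (at t within {0..b})"
      using has_vector_derivative_divide[OF has_vector_derivative_diff[OF 1 G'[OF that]], of "G d"]
      by simp
    moreover have "(g (t + d) - g t) / G d = z * g t"
      using mult[of t d] that d by (simp add: z_def field_simps)
    ultimately have "((\<lambda>t. (G (t + d) - G t) / G d) has_vector_derivative z * g t) (at t within {0..b})"
      by simp
    then show ?thesis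
      by (rule has_vector_derivative_transform[rotated 2])
        (use that d shift in \<open>auto simp: field_simps\<close>)
  qed
  have "g t = exp (of_real t * z)" if t: "t \<ge> 0" for t
  proof -
    have "\<exists>c. \<forall>x\<in>{0..t}. g x * exp (- (of_real x * z)) = c"
    proof (rule has_vector_derivative_zero_constant)
      show "((\<lambda>x. g x * exp (- (of_real x * z))) has_vector_derivative 0) (at x within {0..t})"
        if "x \<in> {0..t}" for x
      proof -
        have "((\<lambda>x. exp (- (of_real x * z))) has_vector_derivative - z * exp (- (of_real x * z)))
            (at x within {0..t})"
        proof -
          have "((\<lambda>w. exp (- (w * z))) has_field_derivative - z * exp (- (of_real x * z)))
             (at (of_real x))"
            by (auto intro!: derivative_eq_intros)
          from has_vector_derivative_real_field[OF this] show ?thesis .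
        qed
        from has_vector_derivative_mult[OF deriv[of x t] this] that show ?thesis
          by (simp add: algebra_simps)
      qed
    qed auto
    then have "g t * exp (- (of_real t * z)) = g 0 * exp (- (of_real 0 * z))"
      using t by (metis atLeastAtMost_iff order_refl)
    then have "g t * (exp (- (of_real t * z)) * exp (of_real t * z)) = exp (of_real t * z)"
      using zero by (simp add: algebra_simps)
    then show ?thesis by (simp flip: exp_add)
  qed
  then show ?thesis by blast
qed

section \<open>Independence from factorising characteristic functions\<close>

lemma borel_measurable_cis [measurable]: "cis \<in> borel_measurable borel"
  by (intro borel_measurable_continuous_onI continuous_intros)

context prob_space
begin

lemma integrable_cis [intro, simp]:
  "U \<in> borel_measurable M \<Longrightarrow> integrable M (\<lambda>\<omega>. cis (U \<omega>))"
  by (rule integrable_const_bound[where B = 1]) auto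

lemma norm_expectation_le_1:
  fixes f :: "'a \<Rightarrow> complex"
  assumes "f \<in> borel_measurable M" "\<And>\<omega>. norm (f \<omega>) \<le> 1"
  shows "norm (\<integral>\<omega>. f \<omega> \<partial>M) \<le> 1"
proof -
  have "norm (\<integral>\<omega>. f \<omega> \<partial>M) \<le> (\<integral>\<omega>. norm (f \<omega>) \<partial>M)" by (rule integral_norm_bound)
  also have "\<dots> \<le> (\<integral>\<omega>. 1 \<partial>M)"
    using assms by (intro integral_mono integrable_const_bound[where B = 1] AE_I2) auto
  finally show ?thesis by (simp add: prob_space)
qed

lemma expectation_indicator_comp:
  assumes [measurable]: "U \<in> borel_measurable M" "A \<in> sets borel"
  shows "(\<integral>\<omega>. (indicator A (U \<omega>) :: real) \<partial>M) = prob (U -` A \<inter> space M)"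
proof -
  have "(\<integral>\<omega>. (indicator A (U \<omega>) :: real) \<partial>M) = (\<integral>\<omega>. indicator (U -` A \<inter> space M) \<omega> \<partial>M)"
    by (intro Bochner_Integration.integral_cong) (auto simp: indicator_def)
  then show ?thesis by simp
qed

text \<open>Reweighting \<open>M\<close> by \<open>w\<close> and normalising gives a probability measure under which, by assumption,
  \<open>U\<close> has the same characteristic function as under \<open>M\<close>; one-dimensional uniqueness then identifies
  the two laws of \<open>U\<close>.\<close>

lemma weighted_law_eq:
  fixes U w :: "'a \<Rightarrow> real"
  assumes [measurable]: "U \<in> borel_measurable M" "w \<in> borel_measurable M" "A \<in> sets borel"
    and w: "\<And>\<omega>. 0 \<le> w \<omega>" "\<And>\<omega>. w \<omega> \<le> B"
    and cf: "\<And>a. (\<integral>\<omega>. of_real (w \<omega>) * cis (a * U \<omega>) \<partial>M) = of_real (expectation w) * (\<integral>\<omega>. cis (a * U \<omega>) \<partial>M)"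
  shows "(\<integral>\<omega>. w \<omega> * indicator A (U \<omega>) \<partial>M) = expectation w * prob (U -` A \<inter> space M)"
proof -
  have int: "integrable M w"
    using w by (intro integrable_const_bound[where B = B]) auto
  have "expectation w \<ge> 0" using w by simp
  show ?thesis
  proof (cases "expectation w = 0")
    case True
    then have "AE \<omega> in M. w \<omega> = 0"
      using integral_nonneg_eq_0_iff_AE[OF int] w by simp
    then have "(\<integral>\<omega>. w \<omega> * indicator A (U \<omega>) \<partial>M) = (\<integral>\<omega>. 0 \<partial>M)"
      by (intro integral_cong_AE) auto
    then show ?thesis using True by simp
  next
    case False
    then have pos: "expectation w > 0" using \<open>expectation w \<ge> 0\<close> by simp
    define v where "v \<omega> = w \<omega> / expectation w" for \<omega>
    have [measurable]: "v \<in> borel_measurable M" unfolding v_def by simp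
    have v: "\<And>\<omega>. 0 \<le> v \<omega>" using w pos by (simp add: v_def)
    have intv: "integrable M v" "expectation v = 1"
      using int pos by (auto simp: v_def [abs_def])
    define D where "D = density M (\<lambda>\<omega>. ennreal (v \<omega>))"
    have [measurable]: "U \<in> borel_measurable D" unfolding D_def by simp
    interpret D: prob_space D
      using intv v by (intro prob_spaceI)
        (simp add: D_def emeasure_density nn_integral_eq_integral cong: nn_integral_cong)
    have "distr D borel U = distr M borel U"
    proof (rule Levy_uniqueness)
      show "real_distribution (distr D borel U)" "real_distribution (distr M borel U)"
        by (auto intro: D.real_distribution_distr real_distribution_distr)
      show "char (distr D borel U) = char (distr M borel U)"
      proof
        fix a
        have "char (distr D borel U) a = (\<integral>\<omega>. cis (a * U \<omega>) \<partial>D)"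
          by (simp add: char_def integral_distr cis_conv_exp)
        also have "\<dots> = (\<integral>\<omega>. of_real (v \<omega>) * cis (a * U \<omega>) \<partial>M)"
          unfolding D_def using v by (subst integral_density) (auto simp: scaleR_conv_of_real)
        also have "\<dots> = (\<integral>\<omega>. of_real (w \<omega>) * cis (a * U \<omega>) \<partial>M) / of_real (expectation w)"
          by (simp add: v_def)
        also have "\<dots> = char (distr M borel U) a"
          using False unfolding cf[of a] by (simp add: char_def integral_distr cis_conv_exp)
        finally show "char (distr D borel U) a = char (distr M borel U) a" .
      qed
    qed
    then have "measure (distr D borel U) A = measure (distr M borel U) A" by simp
    then have "measure D (U -` A \<inter> space M) = prob (U -` A \<inter> space M)"
      by (simp add: measure_distr D_def)
    moreover have "measure D (U -` A \<inter> space M) = (\<integral>\<omega>. v \<omega> * indicator A (U \<omega>) \<partial>M)"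
    proof -
      have "measure D (U -` A \<inter> space M) = (\<integral>\<omega>. indicator (U -` A \<inter> space M) \<omega> \<partial>D)"
        by (simp add: D_def)
      also have "\<dots> = (\<integral>\<omega>. v \<omega> * indicator (U -` A \<inter> space M) \<omega> \<partial>M)"
        unfolding D_def using v by (subst integral_density) auto
      also have "\<dots> = (\<integral>\<omega>. v \<omega> * indicator A (U \<omega>) \<partial>M)"
        by (intro Bochner_Integration.integral_cong) (auto simp: indicator_def)
      finally show ?thesis .
    qed
    ultimately show ?thesis
      using False by (simp add: v_def field_simps)
  qed
qed

text \<open>Two-dimensional uniqueness is obtained by using the one-dimensional theorem twice. The weights
  \<open>2 + cos (b V + c)\<close> are nonnegative and, by the factorisation, uncorrelated with all
  \<open>cis (a U)\<close>; so they are uncorrelated with the indicators of \<open>U\<close>. These indicators are then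
  themselves admissible weights for the law of \<open>V\<close>.\<close>

lemma indep_var_if_char_factors:
  fixes U V :: "'a \<Rightarrow> real"
  assumes [measurable]: "U \<in> borel_measurable M" "V \<in> borel_measurable M"
    and factor: "\<And>a b. (\<integral>\<omega>. cis (a * U \<omega> + b * V \<omega>) \<partial>M)
      = (\<integral>\<omega>. cis (a * U \<omega>) \<partial>M) * (\<integral>\<omega>. cis (b * V \<omega>) \<partial>M)"
  shows "indep_var borel U borel V"
proof -
  have cos_cis: "complex_of_real (cos (x + c)) = (cis c * cis x + cis (-c) * cis (- x)) / 2" for x c
    by (simp add: complex_eq_iff cos_add)
  have cis_split: "cis (x + y) = cis x * cis y" "cis (x - y) = cis x * cis (- y)" for x y
    by (simp_all add: cis_mult)
  \<comment> \<open>The phase \<open>c\<close> lets one computation serve for cosine (\<open>c = 0\<close>) and sine (\<open>c = \<pi>/2\<close>).\<close>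
  have cos_indicator: "(\<integral>\<omega>. indicator A (U \<omega>) * cos (b * V \<omega> + c) \<partial>M)
      = prob (U -` A \<inter> space M) * (\<integral>\<omega>. cos (b * V \<omega> + c) \<partial>M)"
    if [measurable]: "A \<in> sets borel" for A b c
  proof -
    have int: "integrable M (\<lambda>\<omega>. cos (b * V \<omega> + c))"
      by (rule integrable_const_bound[where B = 1]) auto
    have intA: "integrable M (\<lambda>\<omega>. indicator A (U \<omega>) * cos (b * V \<omega> + c))"
      by (rule integrable_const_bound[where B = 1]) (auto simp: indicator_def)
    have intA': "integrable M (\<lambda>\<omega>. indicator A (U \<omega>) :: real)"
      by (rule integrable_const_bound[where B = 1]) (auto simp: indicator_def)
    note eqA = expectation_indicator_comp[OF assms(1) that(1)]
    have "(\<integral>\<omega>. (2 + cos (b * V \<omega> + c)) * indicator A (U \<omega>) \<partial>M)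
        = (\<integral>\<omega>. 2 + cos (b * V \<omega> + c) \<partial>M) * prob (U -` A \<inter> space M)"
    proof (rule weighted_law_eq[where B = 3])
      show "0 \<le> 2 + cos (b * V \<omega> + c)" for \<omega> using cos_ge_minus_one[of "b * V \<omega> + c"] by linarith
      show "2 + cos (b * V \<omega> + c) \<le> 3" for \<omega> by simp
      fix a
      have "(\<integral>\<omega>. of_real (2 + cos (b * V \<omega> + c)) * cis (a * U \<omega>) \<partial>M)
          = (\<integral>\<omega>. 2 * cis (a * U \<omega>) + (cis c / 2 * cis (a * U \<omega> + b * V \<omega>)
               + cis (-c) / 2 * cis (a * U \<omega> + (- b) * V \<omega>)) \<partial>M)"
        by (intro Bochner_Integration.integral_cong refl)
           (simp add: cos_cis cis_split field_simps)
      also have "\<dots> = 2 * (\<integral>\<omega>. cis (a * U \<omega>) \<partial>M) + (cis c / 2 * (\<integral>\<omega>. cis (a * U \<omega> + b * V \<omega>) \<partial>M)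
               + cis (-c) / 2 * (\<integral>\<omega>. cis (a * U \<omega> + (- b) * V \<omega>) \<partial>M))"
        by simp
      also have "\<dots> = (2 + (cis c / 2 * (\<integral>\<omega>. cis (b * V \<omega>) \<partial>M) + cis (-c) / 2 * (\<integral>\<omega>. cis ((-b) * V \<omega>) \<partial>M)))
          * (\<integral>\<omega>. cis (a * U \<omega>) \<partial>M)"
        unfolding factor by (simp add: algebra_simps)
      also have "2 + (cis c / 2 * (\<integral>\<omega>. cis (b * V \<omega>) \<partial>M) + cis (-c) / 2 * (\<integral>\<omega>. cis ((-b) * V \<omega>) \<partial>M))
          = (\<integral>\<omega>. 2 + (cis c / 2 * cis (b * V \<omega>) + cis (-c) / 2 * cis ((-b) * V \<omega>)) \<partial>M)"
        by (simp add: prob_space)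
      also have "\<dots> = (\<integral>\<omega>. of_real (2 + cos (b * V \<omega> + c)) \<partial>M)"
        by (intro Bochner_Integration.integral_cong refl) (simp add: cos_cis field_simps)
      also have "\<dots> = of_real (\<integral>\<omega>. 2 + cos (b * V \<omega> + c) \<partial>M)"
        by (rule integral_complex_of_real)
      finally show "(\<integral>\<omega>. of_real (2 + cos (b * V \<omega> + c)) * cis (a * U \<omega>) \<partial>M)
         = of_real (\<integral>\<omega>. 2 + cos (b * V \<omega> + c) \<partial>M) * (\<integral>\<omega>. cis (a * U \<omega>) \<partial>M)" .
    qed simp_all
    then show ?thesis
      using int intA intA' by (simp add: algebra_simps eqA prob_space)
  qed
  have cis_indicator: "(\<integral>\<omega>. of_real (indicator A (U \<omega>)) * cis (b * V \<omega>) \<partial>M)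
      = of_real (\<integral>\<omega>. indicator A (U \<omega>) \<partial>M) * (\<integral>\<omega>. cis (b * V \<omega>) \<partial>M)"
    if [measurable]: "A \<in> sets borel" for A b
  proof -
    note eqA = expectation_indicator_comp[OF assms(1) that(1)]
    have int: "integrable M (\<lambda>\<omega>. complex_of_real (indicator A (U \<omega>)) * cis (b * V \<omega>))"
      by (rule integrable_const_bound[where B = 1]) (auto simp: indicator_def)
    have intc: "integrable M (\<lambda>\<omega>. cis (b * V \<omega>))" by simp
    have "Re (\<integral>\<omega>. of_real (indicator A (U \<omega>)) * cis (b * V \<omega>) \<partial>M)
        = (\<integral>\<omega>. indicator A (U \<omega>) * cos (b * V \<omega> + 0) \<partial>M)"
      by (subst integral_Re[OF int, symmetric]) simp
    moreover have "Im (\<integral>\<omega>. of_real (indicator A (U \<omega>)) * cis (b * V \<omega>) \<partial>M)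
        = - (\<integral>\<omega>. indicator A (U \<omega>) * cos (b * V \<omega> + pi / 2) \<partial>M)"
      by (subst integral_Im[OF int, symmetric]) (simp add: cos_add)
    moreover have "Re (\<integral>\<omega>. cis (b * V \<omega>) \<partial>M) = (\<integral>\<omega>. cos (b * V \<omega> + 0) \<partial>M)"
      by (subst integral_Re[OF intc, symmetric]) simp
    moreover have "Im (\<integral>\<omega>. cis (b * V \<omega>) \<partial>M) = - (\<integral>\<omega>. cos (b * V \<omega> + pi / 2) \<partial>M)"
      by (subst integral_Im[OF intc, symmetric]) (simp add: cos_add)
    ultimately show ?thesis
      by (simp add: complex_eq_iff cos_indicator eqA del: add_0_right)
  qed
  have prod: "prob ((U -` A \<inter> space M) \<inter> (V -` B \<inter> space M)) = prob (U -` A \<inter> space M) * prob (V -` B \<inter> space M)"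
    if [measurable]: "A \<in> sets borel" "B \<in> sets borel" for A B
  proof -
    have "(\<integral>\<omega>. indicator A (U \<omega>) * indicator B (V \<omega>) \<partial>M)
        = (\<integral>\<omega>. indicator A (U \<omega>) \<partial>M) * prob (V -` B \<inter> space M)"
      by (rule weighted_law_eq[where B = 1]) (auto simp: cis_indicator)
    moreover note expectation_indicator_comp[OF assms(1) that(1)]
    moreover have "(\<integral>\<omega>. indicator A (U \<omega>) * indicator B (V \<omega>) \<partial>M)
        = prob ((U -` A \<inter> space M) \<inter> (V -` B \<inter> space M))"
    proof -
      have "(\<integral>\<omega>. (indicator A (U \<omega>) * indicator B (V \<omega>) :: real) \<partial>M)
          = (\<integral>\<omega>. indicator ((U -` A \<inter> space M) \<inter> (V -` B \<inter> space M)) \<omega> \<partial>M)"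
        by (intro Bochner_Integration.integral_cong) (auto simp: indicator_def)
      then show ?thesis by simp
    qed
    ultimately show ?thesis by simp
  qed
  show ?thesis
    unfolding indep_var_eq
    by (intro conjI indep_set_sigma_sets indep_setI Int_stableI)
       (auto simp: prod intro: exI[of _ "_ \<inter> _"])
qed

end

section \<open>Increments and exponent of a Levy process\<close>

definition process_char :: "'a measure \<Rightarrow> (real \<Rightarrow> 'a \<Rightarrow> 'b::euclidean_space) \<Rightarrow> real \<Rightarrow> 'b \<Rightarrow> complex" where
  "process_char M X t u = (\<integral>\<omega>. cis (u \<bullet> X t \<omega>) \<partial>M)"

lemma levy_process_prob_space: "levy_process M X \<Longrightarrow> prob_space M"
  by (simp add: levy_process_def)

lemma levy_process_measurable:
  "levy_process M X \<Longrightarrow> 0 \<le> t \<Longrightarrow> X t \<in> borel_measurable M"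
  by (simp add: levy_process_def)

lemma comp_borel_measurable:
  assumes "levy_process M X" "0 \<le> t"
  shows "comp1 X t \<in> borel_measurable M" "comp2 X t \<in> borel_measurable M"
  unfolding comp1_def comp2_def using levy_process_measurable[OF assms]
  by (auto simp: borel_prod[symmetric])

lemma levy_process_start: "levy_process M X \<Longrightarrow> AE \<omega> in M. X 0 \<omega> = 0"
  by (simp add: levy_process_def)

lemma levy_process_stationary:
  "levy_process M X \<Longrightarrow> 0 \<le> s \<Longrightarrow> s \<le> t \<Longrightarrow>
    distr M borel (\<lambda>\<omega>. X t \<omega> - X s \<omega>) = distr M borel (X (t - s))"
  by (simp add: levy_process_def)

lemma levy_process_indep:
  "levy_process M X \<Longrightarrow> 0 \<le> t 0 \<Longrightarrow> (\<And>i. i < n \<Longrightarrow> t i \<le> t (Suc i)) \<Longrightarrow>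
    prob_space.indep_vars M (\<lambda>_. borel) (\<lambda>i \<omega>. X (t (Suc i)) \<omega> - X (t i) \<omega>) {..<n}"
  by (simp add: levy_process_def)

lemma levy_process_cadlag: "levy_process M X \<Longrightarrow> AE \<omega> in M. cadlag (\<lambda>t. X t \<omega>)"
  by (simp add: levy_process_def)

lemma levy_process_integral_increment:
  fixes f :: "'b::euclidean_space \<Rightarrow> 'c::{banach, second_countable_topology}"
  assumes X: "levy_process M X" and st: "0 \<le> s" "s \<le> t"
    and [measurable]: "f \<in> borel_measurable borel"
  shows "(\<integral>\<omega>. f (X t \<omega> - X s \<omega>) \<partial>M) = (\<integral>\<omega>. f (X (t - s) \<omega>) \<partial>M)"
proof -
  have [measurable]: "X t \<in> borel_measurable M" "X s \<in> borel_measurable M" "X (t - s) \<in> borel_measurable M"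
    using X st by (auto intro: levy_process_measurable)
  have "(\<integral>\<omega>. f (X t \<omega> - X s \<omega>) \<partial>M) = (\<integral>x. f x \<partial>distr M borel (\<lambda>\<omega>. X t \<omega> - X s \<omega>))"
    by (simp add: integral_distr)
  also have "\<dots> = (\<integral>\<omega>. f (X (t - s) \<omega>) \<partial>M)"
    by (simp add: levy_process_stationary[OF X st] integral_distr)
  finally show ?thesis .
qed

lemma char_of_increments:
  assumes X: "levy_process M X" and t: "0 \<le> t 0" "\<And>i. i < n \<Longrightarrow> t i \<le> t (Suc i)"
  shows "(\<integral>\<omega>. cis (\<Sum>i<n. u i \<bullet> (X (t (Suc i)) \<omega> - X (t i) \<omega>)) \<partial>M)
    = (\<Prod>i<n. process_char M X (t (Suc i) - t i) (u i))"
proof -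
  interpret prob_space M by (rule levy_process_prob_space[OF X])
  have nonneg: "0 \<le> t i" if "i \<le> n" for i
    using that by (induction i) (use t in \<open>auto simp: Suc_le_eq intro: order_trans\<close>)
  have [measurable]: "X (t i) \<in> borel_measurable M" if "i \<le> n" for i
    using X nonneg[OF that] by (rule levy_process_measurable)
  have cis_sum: "cis (\<Sum>i<n. f i) = (\<Prod>i<n. cis (f i))" for f :: "nat \<Rightarrow> real"
    by (induction n) (auto simp flip: cis_mult)
  have "indep_vars (\<lambda>_. borel) (\<lambda>i \<omega>. cis (u i \<bullet> (X (t (Suc i)) \<omega> - X (t i) \<omega>))) {..<n}"
    by (rule indep_vars_compose2[OF levy_process_indep[OF X t]]) auto
  then have "(\<integral>\<omega>. (\<Prod>i<n. cis (u i \<bullet> (X (t (Suc i)) \<omega> - X (t i) \<omega>))) \<partial>M)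
      = (\<Prod>i<n. \<integral>\<omega>. cis (u i \<bullet> (X (t (Suc i)) \<omega> - X (t i) \<omega>)) \<partial>M)"
    by (intro indep_vars_lebesgue_integral) auto
  also have "\<dots> = (\<Prod>i<n. process_char M X (t (Suc i) - t i) (u i))"
    unfolding process_char_def
    by (intro prod.cong refl levy_process_integral_increment[OF X, where f = "\<lambda>x. cis (_ \<bullet> x)"])
      (use t nonneg in auto)
  finally show ?thesis by (simp add: cis_sum)
qed

lemma char_of_three_increments:
  assumes X: "levy_process M X" and r: "0 \<le> r1" "r1 \<le> r2" "r2 \<le> r3"
  shows "(\<integral>\<omega>. cis (u1 \<bullet> X r1 \<omega> + u2 \<bullet> (X r2 \<omega> - X r1 \<omega>) + u3 \<bullet> (X r3 \<omega> - X r2 \<omega>)) \<partial>M)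
    = process_char M X r1 u1 * process_char M X (r2 - r1) u2 * process_char M X (r3 - r2) u3"
proof -
  interpret prob_space M by (rule levy_process_prob_space[OF X])
  have [measurable]: "X r1 \<in> borel_measurable M" "X r2 \<in> borel_measurable M" "X r3 \<in> borel_measurable M"
      "X 0 \<in> borel_measurable M"
    using X r by (auto intro: levy_process_measurable)
  define t where "t = (!) [0, r1, r2, r3]"
  define u where "u = (!) [u1, u2, u3]"
  have "(\<integral>\<omega>. cis (u1 \<bullet> X r1 \<omega> + u2 \<bullet> (X r2 \<omega> - X r1 \<omega>) + u3 \<bullet> (X r3 \<omega> - X r2 \<omega>)) \<partial>M)
      = (\<integral>\<omega>. cis (\<Sum>i<3. u i \<bullet> (X (t (Suc i)) \<omega> - X (t i) \<omega>)) \<partial>M)"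
    using levy_process_start[OF X]
    by (intro integral_cong_AE) (auto simp: t_def u_def numeral_3_eq_3)
  also have "\<dots> = (\<Prod>i<3. process_char M X (t (Suc i) - t i) (u i))"
    by (rule char_of_increments[OF X])
      (use r in \<open>auto simp: t_def numeral_3_eq_3 less_Suc_eq\<close>)
  finally show ?thesis by (simp add: t_def u_def numeral_3_eq_3)
qed

lemma process_char_norm_le: "levy_process M X \<Longrightarrow> norm (process_char M X t u) \<le> 1"
proof -
  assume X: "levy_process M X"
  interpret prob_space M by (rule levy_process_prob_space[OF X])
  have "norm (process_char M X t u) \<le> (\<integral>\<omega>. norm (cis (u \<bullet> X t \<omega>)) \<partial>M)"
    unfolding process_char_def by (rule integral_norm_bound)
  then show ?thesis by (simp add: prob_space)
qed

text \<open>Independent and stationary increments make \<open>t \<mapsto> process_char M X t u\<close> multiplicative, and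
  right-continuity of the paths at \<open>0\<close> makes it tend to \<open>1\<close>.\<close>

lemma ex_char_exponent:
  assumes X: "levy_process M X"
  shows "\<exists>z. \<forall>t\<ge>0. process_char M X t u = exp (of_real t * z)"
proof (rule multiplicative_semigroup_eq_exp)
  interpret prob_space M by (rule levy_process_prob_space[OF X])
  have [measurable]: "X t \<in> borel_measurable M" if "t \<ge> 0" for t
    using X that by (rule levy_process_measurable)
  show zero: "process_char M X 0 u = 1"
  proof -
    have "process_char M X 0 u = (\<integral>\<omega>. 1 \<partial>M)"
      unfolding process_char_def using levy_process_start[OF X]
      by (intro integral_cong_AE) auto
    then show ?thesis by (simp add: prob_space)
  qed
  show "process_char M X (s + t) u = process_char M X s u * process_char M X t u" if "0 \<le> s" "0 \<le> t" for s t
    using char_of_three_increments[OF X, of s "s + t" "s + t" u u 0] that zero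
    by (simp add: algebra_simps) (simp add: process_char_def prob_space flip: inner_add_right)
  show "norm (process_char M X t u) \<le> 1" if "0 \<le> t" for t
    using X by (rule process_char_norm_le)
  show "((\<lambda>t. process_char M X t u) \<longlongrightarrow> 1) (at_right 0)"
  proof (rule tendsto_at_right_sequentially[of _ 1])
    fix h :: "nat \<Rightarrow> real" assume h: "\<And>n. 0 < h n" "\<And>n. h n < 1" "decseq h" "h \<longlonglongrightarrow> 0"
    have [measurable]: "X (h n) \<in> borel_measurable M" for n
      using h(1)[of n] by simp
    have lim: "filterlim h (at_right 0) sequentially"
      using h(4) by (auto simp: filterlim_at h(1) less_imp_neq[OF h(1), symmetric])
    have "(\<lambda>n. \<integral>\<omega>. cis (u \<bullet> X (h n) \<omega>) \<partial>M) \<longlonglongrightarrow> (\<integral>\<omega>. 1 \<partial>M)"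
    proof (rule integral_dominated_convergence[where w = "\<lambda>_. 1"])
      show "AE \<omega> in M. (\<lambda>n. cis (u \<bullet> X (h n) \<omega>)) \<longlonglongrightarrow> 1"
        using levy_process_start[OF X] levy_process_cadlag[OF X]
      proof eventually_elim
        case (elim \<omega>)
        then have "((\<lambda>t. X t \<omega>) \<longlongrightarrow> 0) (at_right 0)" by (force simp: cadlag_def)
        then have "(\<lambda>n. X (h n) \<omega>) \<longlonglongrightarrow> 0"
          by (rule filterlim_compose[OF _ lim])
        then have "(\<lambda>n. cis (u \<bullet> X (h n) \<omega>)) \<longlonglongrightarrow> cis (u \<bullet> 0)"
          by (intro tendsto_intros)
        then show ?case by simp
      qed
    qed (use h in \<open>auto intro!: less_imp_le\<close>)
    then show "(\<lambda>n. process_char M X (h n) u) \<longlonglongrightarrow> 1"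
      by (simp add: process_char_def prob_space)
  qed simp
qed

text \<open>The choice is harmless: \<open>exp_real_multiples_inject\<close> below shows that the exponent is unique,
  because the identity is required for all times and not just for \<open>t = 1\<close>.\<close>

definition char_exponent :: "'a measure \<Rightarrow> (real \<Rightarrow> 'a \<Rightarrow> 'b::euclidean_space) \<Rightarrow> 'b \<Rightarrow> complex" where
  "char_exponent M X u = (SOME z. \<forall>t\<ge>0. process_char M X t u = exp (of_real t * z))"

lemma process_char_eq_exp:
  "levy_process M X \<Longrightarrow> 0 \<le> t \<Longrightarrow> process_char M X t u = exp (of_real t * char_exponent M X u)"
  using someI_ex[OF ex_char_exponent] unfolding char_exponent_def by blast

lemma exp_eq_1_imp_zero:
  assumes "exp z = 1" "norm z < 2 * pi"
  shows "z = (0 :: complex)"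
proof -
  obtain n :: int where n: "Re z = 0" "Im z = of_int (2 * n) * pi"
    using assms(1) by (auto simp: exp_eq_1)
  have "\<bar>Im z\<bar> = 2 * (\<bar>real_of_int n\<bar> * pi)"
    using n(2) by (simp add: abs_mult)
  then have "\<bar>real_of_int n\<bar> * pi < 1 * pi"
    using abs_Im_le_cmod[of z] assms(2) by linarith
  then have "\<bar>real_of_int n\<bar> < 1"
    by (rule mult_right_less_imp_less) simp
  then show ?thesis
    using n by (simp add: complex_eq_iff)
qed

lemma exp_real_multiples_inject:
  fixes z w :: complex
  assumes "\<And>t. 0 \<le> t \<Longrightarrow> exp (of_real t * z) = exp (of_real t * w)"
  shows "z = w"
proof -
  \<comment> \<open>A time so small that \<open>t * (z - w)\<close> cannot be a nonzero period of \<open>exp\<close>.\<close>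
  define t where "t = 1 / (1 + norm (z - w))"
  have t: "0 < t" "t * norm (z - w) < 1"
    by (auto simp: t_def field_simps add_pos_nonneg)
  have "exp (of_real t * (z - w)) = 1"
    using assms[of t] t by (simp add: right_diff_distrib exp_diff)
  moreover have "norm (of_real t * (z - w)) < 2 * pi"
    using t pi_gt3 by (simp add: norm_mult)
  ultimately have "of_real t * (z - w) = 0"
    by (rule exp_eq_1_imp_zero)
  then show ?thesis using t by simp
qed

section \<open>A Levy process evaluated at independent random times\<close>

lemma char_exponent_zero:
  assumes X: "levy_process M X"
  shows "char_exponent M X 0 = 0"
proof (rule exp_real_multiples_inject)
  interpret prob_space M by (rule levy_process_prob_space[OF X])
  show "exp (of_real t * char_exponent M X 0) = exp (of_real t * 0)" if "0 \<le> t" for t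
    using process_char_eq_exp[OF X that, of 0] by (simp add: process_char_def prob_space)
qed

lemma Re_char_exponent_le:
  assumes X: "levy_process M X"
  shows "Re (char_exponent M X u) \<le> 0"
  using process_char_norm_le[OF X, of 1 u] process_char_eq_exp[OF X, of 1 u] by simp

text \<open>The length of the intersection of the intervals \<open>[0, a]\<close> and \<open>[b, c]\<close>.\<close>

definition overlap :: "real \<Rightarrow> real \<Rightarrow> real \<Rightarrow> real" where
  "overlap a b c = max 0 (min a c - b)"

lemma overlap_bounds:
  assumes "0 \<le> a" "0 \<le> b" "b \<le> c"
  shows "0 \<le> overlap a b c" "overlap a b c \<le> a" "overlap a b c \<le> c - b"
  using assms by (auto simp: overlap_def)

text \<open>The joint characteristic function, at \<open>u\<close> and \<open>v\<close>, of the increments of \<open>X\<close> over \<open>[0, a]\<close> and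
  \<open>[b, c]\<close>: the part common to both intervals is weighted by \<open>u + v\<close>.\<close>

definition overlap_char ::
  "'a measure \<Rightarrow> (real \<Rightarrow> 'a \<Rightarrow> 'b::euclidean_space) \<Rightarrow> 'b \<Rightarrow> 'b \<Rightarrow> real \<Rightarrow> real \<Rightarrow> real \<Rightarrow> complex" where
  "overlap_char M X u v a b c =
     exp (of_real (overlap a b c) * char_exponent M X (u + v)
        + of_real (a - overlap a b c) * char_exponent M X u
        + of_real (c - b - overlap a b c) * char_exponent M X v)"

text \<open>The points \<open>a\<close>, \<open>b\<close>, \<open>c\<close> cut off three consecutive intervals; which of \<open>u\<close>, \<open>v\<close>
  or \<open>u + v\<close> acts on each of them depends on the position of \<open>a\<close> relative to \<open>b\<close> and \<open>c\<close>.\<close>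

lemma char_of_overlapping_increments:
  assumes X: "levy_process M X" and abc: "0 \<le> a" "0 \<le> b" "b \<le> c"
  shows "(\<integral>\<omega>. cis (u \<bullet> X a \<omega> + v \<bullet> (X c \<omega> - X b \<omega>)) \<partial>M) = overlap_char M X u v a b c"
proof -
  have *: "(\<integral>\<omega>. cis (u1 \<bullet> X r1 \<omega> + u2 \<bullet> (X r2 \<omega> - X r1 \<omega>) + u3 \<bullet> (X r3 \<omega> - X r2 \<omega>)) \<partial>M)
      = exp (of_real r1 * char_exponent M X u1 + of_real (r2 - r1) * char_exponent M X u2
          + of_real (r3 - r2) * char_exponent M X u3)"
    if "0 \<le> r1" "r1 \<le> r2" "r2 \<le> r3" for u1 u2 u3 r1 r2 r3
    using char_of_three_increments[OF X that] that by (simp add: process_char_eq_exp[OF X] exp_add)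
  consider "a \<le> b" | "b < a" "a \<le> c" | "c < a" by linarith
  then show ?thesis
  proof cases
    case 1
    then have "overlap a b c = 0" by (simp add: overlap_def)
    then show ?thesis
      using *[of a b c u 0 v] 1 abc by (simp add: overlap_char_def char_exponent_zero[OF X])
  next
    case 2
    then have ov: "overlap a b c = a - b" by (simp add: overlap_def)
    have split: "u \<bullet> X a \<omega> + v \<bullet> (X c \<omega> - X b \<omega>) = u \<bullet> X b \<omega> + (u + v) \<bullet> (X a \<omega> - X b \<omega>) + v \<bullet> (X c \<omega> - X a \<omega>)" for \<omega>
      by (simp add: inner_diff_right inner_add_left)
    show ?thesis
      unfolding split overlap_char_def ov
      by (subst *) (use 2 abc in \<open>auto simp: add_ac\<close>)
  next
    case 3
    then have ov: "overlap a b c = c - b" using abc by (simp add: overlap_def)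
    have split: "u \<bullet> X a \<omega> + v \<bullet> (X c \<omega> - X b \<omega>) = u \<bullet> X b \<omega> + (u + v) \<bullet> (X c \<omega> - X b \<omega>) + u \<bullet> (X a \<omega> - X c \<omega>)" for \<omega>
      by (simp add: inner_diff_right inner_add_left)
    show ?thesis
      unfolding split overlap_char_def ov
      by (subst *) (use 3 abc in \<open>auto simp: algebra_simps\<close>)
  qed
qed

text \<open>An elementary form of conditioning: as \<open>\<tau>\<close> takes countably many values, the expectation splits
  into the events \<open>\<tau> = k\<close>, on each of which \<open>Z k\<close> decouples from \<open>\<tau>\<close>. Finitely many values are
  treated at a time and the remaining mass is removed by dominated convergence.\<close>

lemma (in prob_space) integral_discrete_substitution:
  fixes \<tau> :: "'a \<Rightarrow> 'i::countable" and Z :: "'i \<Rightarrow> 'a \<Rightarrow> complex"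
  assumes [measurable]: "\<tau> \<in> measurable M (count_space UNIV)" "\<And>k. Z k \<in> borel_measurable M"
    and bound: "\<And>k \<omega>. norm (Z k \<omega>) \<le> 1"
    and indep: "\<And>k. (\<integral>\<omega>. indicator {k} (\<tau> \<omega>) * Z k \<omega> \<partial>M) = (\<integral>\<omega>. indicator {k} (\<tau> \<omega>) \<partial>M) * (\<integral>\<omega>. Z k \<omega> \<partial>M)"
  shows "(\<integral>\<omega>. Z (\<tau> \<omega>) \<omega> \<partial>M) = (\<integral>\<omega>. (\<integral>\<omega>'. Z (\<tau> \<omega>) \<omega>' \<partial>M) \<partial>M)"
proof -
  define h where "h k = (\<integral>\<omega>'. Z k \<omega>' \<partial>M)" for k
  have [measurable]: "h \<in> borel_measurable (count_space UNIV)" by simp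
  have [measurable]: "(\<lambda>\<omega>. Z (\<tau> \<omega>) \<omega>) \<in> borel_measurable M"
    by (rule measurable_compose_countable[where g = \<tau>]) measurable
  have h_bound: "norm (h k) \<le> 1" for k
    unfolding h_def using bound by (intro norm_expectation_le_1) simp_all
  define S where "S n = {k :: 'i. to_nat k < n}" for n
  have fin: "finite (S n)" for n
  proof (rule finite_imageD)
    show "finite (to_nat ` S n)" by (rule finite_subset[of _ "{..<n}"]) (auto simp: S_def)
    show "inj_on to_nat (S n)" by (rule inj_on_subset[OF inj_to_nat]) simp
  qed
  have expand: "indicator (S n) (\<tau> \<omega>) * f (\<tau> \<omega>) = (\<Sum>k\<in>S n. indicator {k} (\<tau> \<omega>) * f k)"
    for n \<omega> and f :: "'i \<Rightarrow> complex"
  proof -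
    have "(\<Sum>k\<in>S n. indicator {k} (\<tau> \<omega>) * f k) = (\<Sum>k\<in>S n. if k = \<tau> \<omega> then f k else 0)"
      by (intro sum.cong refl) (simp add: indicator_def)
    then show ?thesis using fin[of n] by (simp add: indicator_def)
  qed
  have expand_Z: "indicator (S n) (\<tau> \<omega>) * Z (\<tau> \<omega>) \<omega> = (\<Sum>k\<in>S n. indicator {k} (\<tau> \<omega>) * Z k \<omega>)" for n \<omega>
    using expand[of n \<omega> "\<lambda>k. Z k \<omega>"] .
  have ind_bound: "norm (indicator A k * c) \<le> 1" if "norm c \<le> 1" for A and k :: 'i and c :: complex
    using that by (simp add: indicator_def)
  have ind_meas [measurable]: "(\<lambda>\<omega>. indicator A (\<tau> \<omega>) :: complex) \<in> borel_measurable M" for A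
    by (rule measurable_compose[OF assms(1)]) simp
  have int_Z: "integrable M (\<lambda>\<omega>. indicator {k} (\<tau> \<omega>) * Z k \<omega>)" for k
    by (rule integrable_const_bound[where B = 1, OF AE_I2[OF ind_bound[OF bound]]])
      (intro borel_measurable_times ind_meas assms(2))
  have int_h: "integrable M (\<lambda>\<omega>. indicator {k} (\<tau> \<omega>) * h k)" for k
    by (rule integrable_const_bound[where B = 1, OF AE_I2[OF ind_bound[OF h_bound]]])
      (intro borel_measurable_times ind_meas borel_measurable_const)
  have partial: "(\<integral>\<omega>. indicator (S n) (\<tau> \<omega>) * Z (\<tau> \<omega>) \<omega> \<partial>M) = (\<integral>\<omega>. indicator (S n) (\<tau> \<omega>) * h (\<tau> \<omega>) \<partial>M)" for n
  proof -
    have "(\<integral>\<omega>. indicator (S n) (\<tau> \<omega>) * Z (\<tau> \<omega>) \<omega> \<partial>M) = (\<Sum>k\<in>S n. (\<integral>\<omega>. indicator {k} (\<tau> \<omega>) * Z k \<omega> \<partial>M))"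
      unfolding expand_Z by (intro Bochner_Integration.integral_sum int_Z)
    also have "\<dots> = (\<Sum>k\<in>S n. (\<integral>\<omega>. indicator {k} (\<tau> \<omega>) * h k \<partial>M))"
      unfolding indep h_def by simp
    also have "\<dots> = (\<integral>\<omega>. (\<Sum>k\<in>S n. indicator {k} (\<tau> \<omega>) * h k) \<partial>M)"
      by (intro Bochner_Integration.integral_sum[symmetric] int_h)
    finally show ?thesis unfolding expand .
  qed
  have lim: "(\<lambda>n. indicator (S n) k * c) \<longlonglongrightarrow> c" for k and c :: complex
  proof (rule tendsto_eventually)
    show "\<forall>\<^sub>F n in sequentially. indicator (S n) k * c = c"
      using eventually_gt_at_top[of "to_nat k"] by eventually_elim (simp add: S_def)
  qed
  have "(\<lambda>n. \<integral>\<omega>. indicator (S n) (\<tau> \<omega>) * Z (\<tau> \<omega>) \<omega> \<partial>M) \<longlonglongrightarrow> (\<integral>\<omega>. Z (\<tau> \<omega>) \<omega> \<partial>M)"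
    by (rule integral_dominated_convergence[where w = "\<lambda>_. 1"])
      (auto intro: AE_I2[OF lim] AE_I2[OF ind_bound[OF bound]])
  moreover have "(\<lambda>n. \<integral>\<omega>. indicator (S n) (\<tau> \<omega>) * h (\<tau> \<omega>) \<partial>M) \<longlonglongrightarrow> (\<integral>\<omega>. h (\<tau> \<omega>) \<partial>M)"
    by (rule integral_dominated_convergence[where w = "\<lambda>_. 1"])
      (auto intro: AE_I2[OF lim] AE_I2[OF ind_bound[OF h_bound]])
  ultimately show ?thesis
    unfolding partial h_def by (rule LIMSEQ_unique)
qed

lemma indep_processes_integral_mult:
  fixes f :: "(real \<Rightarrow> 'b::topological_space) \<Rightarrow> complex" and g :: "(real \<Rightarrow> 'b) \<Rightarrow> complex"
  assumes M: "prob_space M" and TX: "indep_processes M T X"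
    and f: "f \<in> borel_measurable path_space" and g: "g \<in> borel_measurable path_space"
    and bound: "\<And>x. norm (f x) \<le> 1" "\<And>x. norm (g x) \<le> 1"
  shows "(\<integral>\<omega>. f (path_of T \<omega>) * g (path_of X \<omega>) \<partial>M)
    = (\<integral>\<omega>. f (path_of T \<omega>) \<partial>M) * (\<integral>\<omega>. g (path_of X \<omega>) \<partial>M)"
proof -
  interpret prob_space M by (rule M)
  have TX': "indep_var path_space (path_of T) path_space (path_of X)"
    using TX unfolding indep_processes_def .
  note T = indep_var_rv1[OF TX'] and X = indep_var_rv2[OF TX']
  have "indep_var borel (\<lambda>\<omega>. f (path_of T \<omega>)) borel (\<lambda>\<omega>. g (path_of X \<omega>))"
    using indep_var_compose[OF TX' f g] by (simp only: o_def)
  then show ?thesis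
    by (rule indep_var_lebesgue_integral)
      (intro integrable_const_bound[where B = 1] AE_I2 bound measurable_compose[OF T f] measurable_compose[OF X g])+
qed

text \<open>The grid is shifted by one so that \<open>grid_point n (grid_index n x)\<close> lies strictly to the right
  of \<open>x\<close>: paths are right-continuous, so approximating a random time from above is the direction in
  which the values of the process converge.\<close>

definition grid_point :: "nat \<Rightarrow> nat \<Rightarrow> real" where
  "grid_point n k = (real k + 1) / (real n + 1)"

definition grid_index :: "nat \<Rightarrow> real \<Rightarrow> nat" where
  "grid_index n x = nat \<lfloor>(real n + 1) * x\<rfloor>"

lemma grid_point_nonneg: "0 \<le> grid_point n k"
  by (simp add: grid_point_def)

lemma grid_point_mono: "x \<le> y \<Longrightarrow> grid_point n (grid_index n x) \<le> grid_point n (grid_index n y)"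
  by (auto simp: grid_point_def grid_index_def intro!: divide_right_mono nat_mono floor_mono mult_left_mono)

lemma filterlim_grid_point:
  assumes "0 \<le> x"
  shows "filterlim (\<lambda>n. grid_point n (grid_index n x)) (at_right x) sequentially"
proof -
  have k: "real (grid_index n x) \<le> (real n + 1) * x" "(real n + 1) * x < real (grid_index n x) + 1" for n
    using assms by (auto simp: grid_index_def of_nat_nat)
  have low: "x < grid_point n (grid_index n x)" for n
    using k[of n] by (simp add: grid_point_def field_simps)
  have up: "grid_point n (grid_index n x) \<le> x + 1 / (real n + 1)" for n
  proof -
    have "grid_point n (grid_index n x) \<le> ((real n + 1) * x + 1) / (real n + 1)"
      unfolding grid_point_def using k(1)[of n] by (intro divide_right_mono) auto
    also have "\<dots> = x + 1 / (real n + 1)" by (simp add: field_simps)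
    finally show ?thesis .
  qed
  have "(\<lambda>n. 1 / real (Suc n)) \<longlonglongrightarrow> 0"
    by (rule LIMSEQ_Suc[OF lim_1_over_n])
  from tendsto_add[OF tendsto_const this, of x]
  have "(\<lambda>n. x + 1 / (real n + 1)) \<longlonglongrightarrow> x"
    by (simp only: of_nat_Suc add_0_right add.commute[of 1])
  from tendsto_sandwich[OF _ _ tendsto_const this]
  have "(\<lambda>n. grid_point n (grid_index n x)) \<longlonglongrightarrow> x"
    using low[THEN less_imp_le] up by simp
  moreover have "\<forall>n. grid_point n (grid_index n x) \<in> {x<..} \<and> grid_point n (grid_index n x) \<noteq> x"
    using low less_imp_neq[OF low, symmetric] by simp
  ultimately show ?thesis
    by (simp add: filterlim_at)
qed

text \<open>For times that are functions of an independent process, the characteristic function is that at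
  deterministic times, averaged over the times. Evaluation of a path at a varying time is not
  measurable on the product space, so the times are first rounded to a countable grid, where
  \<open>integral_discrete_substitution\<close> applies, and the mesh is then refined. For the same reason measurability
  of the limit is an assumption; for a subordinated process that is a Levy process it holds by
  definition.\<close>

lemma char_at_random_times:
  fixes X :: "real \<Rightarrow> 'a \<Rightarrow> 'b::euclidean_space"
  assumes X: "levy_process M X" and TX: "indep_processes M T X"
    and abc [measurable]: "a \<in> borel_measurable path_space" "b \<in> borel_measurable path_space" "c \<in> borel_measurable path_space"
    and ord: "AE \<omega> in M. 0 \<le> a (path_of T \<omega>) \<and> 0 \<le> b (path_of T \<omega>) \<and> b (path_of T \<omega>) \<le> c (path_of T \<omega>)"
    and meas [measurable]: "(\<lambda>\<omega>. u \<bullet> X (a (path_of T \<omega>)) \<omega> + v \<bullet> (X (c (path_of T \<omega>)) \<omega> - X (b (path_of T \<omega>)) \<omega>)) \<in> borel_measurable M"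
  shows "(\<integral>\<omega>. cis (u \<bullet> X (a (path_of T \<omega>)) \<omega> + v \<bullet> (X (c (path_of T \<omega>)) \<omega> - X (b (path_of T \<omega>)) \<omega>)) \<partial>M)
    = (\<integral>\<omega>. overlap_char M X u v (a (path_of T \<omega>)) (b (path_of T \<omega>)) (c (path_of T \<omega>)) \<partial>M)"
proof -
  interpret prob_space M by (rule levy_process_prob_space[OF X])
  have TX': "indep_var path_space (path_of T) path_space (path_of X)"
    using TX unfolding indep_processes_def .
  have T [measurable]: "path_of T \<in> measurable M path_space"
    using indep_var_rv1[OF TX'] by auto
  have [measurable]: "X t \<in> borel_measurable M" if "t \<ge> 0" for t
    using X that by (rule levy_process_measurable)
  define Z where "Z n = (\<lambda>(i, j, k) x. cis (u \<bullet> x (grid_point n i) + v \<bullet> (x (grid_point n k) - x (grid_point n j))))"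
    for n and x :: "real \<Rightarrow> 'b"
  define \<tau> where "\<tau> n x = (grid_index n (a x), grid_index n (b x), grid_index n (c x))"
    for n and x :: "real \<Rightarrow> 'b"
  have [measurable]: "grid_index n \<in> measurable borel (count_space UNIV)" for n
    unfolding grid_index_def by measurable
  have \<tau> [measurable]: "\<tau> n \<in> measurable path_space (count_space UNIV)" for n
    unfolding \<tau>_def by measurable
  have Z [measurable]: "Z n k \<in> borel_measurable path_space" for n k
  proof -
    have [measurable]: "(\<lambda>x. x (grid_point n i)) \<in> borel_measurable (path_space :: (real \<Rightarrow> 'b) measure)" for i
      by (rule measurable_component_singleton) (simp add: grid_point_nonneg)
    show ?thesis unfolding Z_def by (cases k) simp
  qed
  have X_path [measurable]: "path_of X \<in> measurable M path_space"
    using indep_var_rv2[OF TX'] by auto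
  have path_X: "path_of X \<omega> (grid_point n i) = X (grid_point n i) \<omega>" for \<omega> n i
    by (simp add: path_of_def grid_point_nonneg)
  have Z_bound: "norm (Z n k x) \<le> 1" for n k x
    by (cases k) (simp add: Z_def)
  define h where "h n k = (\<integral>\<omega>. Z n k (path_of X \<omega>) \<partial>M)" for n k
  have h_bound: "norm (h n k) \<le> 1" for n k
    unfolding h_def by (intro norm_expectation_le_1 Z_bound measurable_compose[OF X_path Z])
  let ?grid = "\<lambda>n x. grid_point n (grid_index n x)"
  have discrete: "(\<integral>\<omega>. Z n (\<tau> n (path_of T \<omega>)) (path_of X \<omega>) \<partial>M) = (\<integral>\<omega>. h n (\<tau> n (path_of T \<omega>)) \<partial>M)" for n
    unfolding h_def
  proof (rule integral_discrete_substitution)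
    show "norm (Z n k (path_of X \<omega>)) \<le> 1" for k \<omega> by (rule Z_bound)
    fix k
    have ind: "(\<lambda>x. indicator {k} (\<tau> n x) :: complex) \<in> borel_measurable path_space"
      by (rule measurable_compose[OF \<tau>]) simp
    have ind_bound: "norm (indicator {k} (\<tau> n x) :: complex) \<le> 1" for x
      by (simp add: indicator_def)
    show "(\<integral>\<omega>. indicator {k} (\<tau> n (path_of T \<omega>)) * Z n k (path_of X \<omega>) \<partial>M)
        = (\<integral>\<omega>. indicator {k} (\<tau> n (path_of T \<omega>)) \<partial>M) * (\<integral>\<omega>. Z n k (path_of X \<omega>) \<partial>M)"
      by (rule indep_processes_integral_mult[OF prob_space_axioms TX ind Z ind_bound Z_bound])
    show "(\<lambda>\<omega>. Z n k (path_of X \<omega>)) \<in> borel_measurable M"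
      by (rule measurable_compose[OF X_path Z])
  next
    show "(\<lambda>\<omega>. \<tau> n (path_of T \<omega>)) \<in> measurable M (count_space UNIV)"
      by (rule measurable_compose[OF T \<tau>])
  qed
  have "(\<lambda>n. \<integral>\<omega>. Z n (\<tau> n (path_of T \<omega>)) (path_of X \<omega>) \<partial>M)
      \<longlonglongrightarrow> (\<integral>\<omega>. cis (u \<bullet> X (a (path_of T \<omega>)) \<omega> + v \<bullet> (X (c (path_of T \<omega>)) \<omega> - X (b (path_of T \<omega>)) \<omega>)) \<partial>M)"
  proof (rule integral_dominated_convergence[where w = "\<lambda>_. 1"])
    show "AE \<omega> in M. (\<lambda>n. Z n (\<tau> n (path_of T \<omega>)) (path_of X \<omega>)) \<longlonglongrightarrow>
        cis (u \<bullet> X (a (path_of T \<omega>)) \<omega> + v \<bullet> (X (c (path_of T \<omega>)) \<omega> - X (b (path_of T \<omega>)) \<omega>))"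
      using ord levy_process_cadlag[OF X]
    proof eventually_elim
      case (elim \<omega>)
      have conv: "(\<lambda>n. X (?grid n r) \<omega>) \<longlonglongrightarrow> X r \<omega>" if "0 \<le> r" for r
      proof -
        have "((\<lambda>t. X t \<omega>) \<longlongrightarrow> X r \<omega>) (at_right r)"
          using elim that by (auto simp: cadlag_def)
        then show ?thesis by (rule filterlim_compose[OF _ filterlim_grid_point[OF that]])
      qed
      have "0 \<le> c (path_of T \<omega>)" using elim by linarith
      with elim conv show ?case
        unfolding Z_def \<tau>_def prod.case path_X by (intro tendsto_intros) simp_all
    qed
    show "(\<lambda>\<omega>. Z n (\<tau> n (path_of T \<omega>)) (path_of X \<omega>)) \<in> borel_measurable M" for n
      by (rule measurable_compose_countable[where g = "\<lambda>\<omega>. \<tau> n (path_of T \<omega>)"])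
        (rule measurable_compose[OF X_path Z], rule measurable_compose[OF T \<tau>])
    show "AE \<omega> in M. norm (Z n (\<tau> n (path_of T \<omega>)) (path_of X \<omega>)) \<le> 1" for n
      using Z_bound by (intro AE_I2)
    show "(\<lambda>\<omega>. cis (u \<bullet> X (a (path_of T \<omega>)) \<omega> + v \<bullet> (X (c (path_of T \<omega>)) \<omega> - X (b (path_of T \<omega>)) \<omega>)))
      \<in> borel_measurable M"
      by (rule measurable_compose[OF meas borel_measurable_cis])
  qed simp
  moreover have "(\<lambda>n. \<integral>\<omega>. h n (\<tau> n (path_of T \<omega>)) \<partial>M)
      \<longlonglongrightarrow> (\<integral>\<omega>. overlap_char M X u v (a (path_of T \<omega>)) (b (path_of T \<omega>)) (c (path_of T \<omega>)) \<partial>M)"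
  proof (rule integral_dominated_convergence[where w = "\<lambda>_. 1"])
    show "AE \<omega> in M. (\<lambda>n. h n (\<tau> n (path_of T \<omega>))) \<longlonglongrightarrow>
        overlap_char M X u v (a (path_of T \<omega>)) (b (path_of T \<omega>)) (c (path_of T \<omega>))"
      using ord
    proof eventually_elim
      case (elim \<omega>)
      define r1 r2 r3 where "r1 = a (path_of T \<omega>)" "r2 = b (path_of T \<omega>)" "r3 = c (path_of T \<omega>)"
      have r: "0 \<le> r1" "0 \<le> r2" "r2 \<le> r3" using elim by (auto simp: r1_r2_r3_def)
      have "h n (\<tau> n (path_of T \<omega>)) = overlap_char M X u v (?grid n r1) (?grid n r2) (?grid n r3)" for n
        unfolding h_def Z_def \<tau>_def prod.case path_X r1_r2_r3_def[symmetric]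
        by (intro char_of_overlapping_increments[OF X] grid_point_nonneg grid_point_mono r)
      moreover have conv: "(\<lambda>n. ?grid n r) \<longlonglongrightarrow> r" if "0 \<le> r" for r
        using filterlim_grid_point[OF that] by (simp add: filterlim_at)
      have "(\<lambda>n. overlap_char M X u v (?grid n r1) (?grid n r2) (?grid n r3)) \<longlonglongrightarrow> overlap_char M X u v r1 r2 r3"
        unfolding overlap_char_def overlap_def
        by (intro tendsto_intros conv r order_trans[OF r(2,3)])
      ultimately show ?case by (simp add: r1_r2_r3_def)
    qed
    show "(\<lambda>\<omega>. overlap_char M X u v (a (path_of T \<omega>)) (b (path_of T \<omega>)) (c (path_of T \<omega>))) \<in> borel_measurable M"
      unfolding overlap_char_def overlap_def
      using measurable_compose[OF T abc(1)] measurable_compose[OF T abc(2)] measurable_compose[OF T abc(3)]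
      by simp
    show "(\<lambda>\<omega>. h n (\<tau> n (path_of T \<omega>))) \<in> borel_measurable M" for n
      by (rule measurable_compose[OF measurable_compose[OF T \<tau>]]) simp
    show "AE \<omega> in M. norm (h n (\<tau> n (path_of T \<omega>))) \<le> 1" for n
      using h_bound by (intro AE_I2)
  qed simp
  ultimately show ?thesis
    unfolding discrete by (rule LIMSEQ_unique)
qed

section \<open>The overlap identity for a subordinated Levy process\<close>

text \<open>Independence of \<open>X s\<close> and \<open>X t - X s\<close> comes from the increments over the grid \<open>0, s, t\<close>,
  since \<open>X 0\<close> vanishes almost surely.\<close>

lemma levy_process_integral_mult:
  fixes f g :: "'b::euclidean_space \<Rightarrow> complex"
  assumes X: "levy_process M X" and st: "0 \<le> s" "s \<le> t"
    and f: "f \<in> borel_measurable borel" and g: "g \<in> borel_measurable borel"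
    and bound: "\<And>x. norm (f x) \<le> 1" "\<And>x. norm (g x) \<le> 1"
  shows "(\<integral>\<omega>. f (X s \<omega>) * g (X t \<omega> - X s \<omega>) \<partial>M)
    = (\<integral>\<omega>. f (X s \<omega>) \<partial>M) * (\<integral>\<omega>. g (X t \<omega> - X s \<omega>) \<partial>M)"
proof -
  interpret prob_space M by (rule levy_process_prob_space[OF X])
  have meas [measurable]: "X s \<in> borel_measurable M" "X t \<in> borel_measurable M" "X 0 \<in> borel_measurable M"
    using X st by (auto intro: levy_process_measurable)
  have fm: "(\<lambda>\<omega>. f (X s \<omega>)) \<in> borel_measurable M" "(\<lambda>\<omega>. f (X s \<omega> - X 0 \<omega>)) \<in> borel_measurable M"
    and gm: "(\<lambda>\<omega>. g (X t \<omega> - X s \<omega>)) \<in> borel_measurable M"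
    by (auto intro: measurable_compose[OF _ f] measurable_compose[OF _ g])
  define r where "r = (!) [0, s, t]"
  define F where "F i = (if i = (0::nat) then f else g)" for i
  have "indep_vars (\<lambda>_. borel) (\<lambda>i \<omega>. X (r (Suc i)) \<omega> - X (r i) \<omega>) {..<2}"
    by (rule levy_process_indep[OF X]) (use st in \<open>auto simp: r_def less_Suc_eq numeral_2_eq_2\<close>)
  then have ind: "indep_vars (\<lambda>_. borel) (\<lambda>i \<omega>. F i (X (r (Suc i)) \<omega> - X (r i) \<omega>)) {..<2}"
    by (rule indep_vars_compose2) (simp add: F_def f g)
  have int: "integrable M (\<lambda>\<omega>. F i (X (r (Suc i)) \<omega> - X (r i) \<omega>))" if "i \<in> {..<2}" for i
  proof -
    have "(\<lambda>\<omega>. F i (X (r (Suc i)) \<omega> - X (r i) \<omega>)) \<in> borel_measurable M"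
      using that fm gm by (auto simp: F_def r_def less_Suc_eq numeral_2_eq_2)
    then show ?thesis
      by (rule integrable_const_bound[where B = 1, rotated]) (simp add: F_def bound)
  qed
  have "(\<integral>\<omega>. (\<Prod>i<2. F i (X (r (Suc i)) \<omega> - X (r i) \<omega>)) \<partial>M)
      = (\<Prod>i<2. \<integral>\<omega>. F i (X (r (Suc i)) \<omega> - X (r i) \<omega>) \<partial>M)"
    by (rule indep_vars_lebesgue_integral[OF _ ind int]) simp_all
  then have "(\<integral>\<omega>. f (X s \<omega> - X 0 \<omega>) * g (X t \<omega> - X s \<omega>) \<partial>M)
    = (\<integral>\<omega>. f (X s \<omega> - X 0 \<omega>) \<partial>M) * (\<integral>\<omega>. g (X t \<omega> - X s \<omega>) \<partial>M)"
    by (simp add: numeral_2_eq_2 F_def r_def)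
  moreover have "(\<integral>\<omega>. f (X s \<omega> - X 0 \<omega>) \<partial>M) = (\<integral>\<omega>. f (X s \<omega>) \<partial>M)"
    using levy_process_start[OF X] fm by (intro integral_cong_AE) auto
  moreover have "(\<integral>\<omega>. f (X s \<omega> - X 0 \<omega>) * g (X t \<omega> - X s \<omega>) \<partial>M) = (\<integral>\<omega>. f (X s \<omega>) * g (X t \<omega> - X s \<omega>) \<partial>M)"
    using levy_process_start[OF X] fm gm by (intro integral_cong_AE borel_measurable_times) auto
  ultimately show ?thesis by simp
qed

locale subordinated_levy =
  fixes M :: "'a measure" and X T :: "real \<Rightarrow> 'a \<Rightarrow> real \<times> real"
  assumes X: "levy_process M X"
    and T: "bivariate_subordinator M T"
    and TX: "indep_processes M T X"
    and Y: "levy_process M (subordinate X T)"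
begin

lemma T_levy: "levy_process M T"
  using T by (simp add: bivariate_subordinator_def)

sublocale prob_space M
  by (rule levy_process_prob_space[OF X])

lemma T_measurable [measurable]: "0 \<le> t \<Longrightarrow> T t \<in> borel_measurable M"
  using T_levy by (rule levy_process_measurable)

lemmas comp_measurable [measurable] = comp_borel_measurable[OF T_levy]

lemma AE_T_mono:
  "AE \<omega> in M. T 0 \<omega> = 0 \<and> (\<forall>s t. 0 \<le> s \<and> s \<le> t \<longrightarrow>
      0 \<le> comp1 T s \<omega> \<and> 0 \<le> comp2 T s \<omega> \<and> comp1 T s \<omega> \<le> comp1 T t \<omega> \<and> comp2 T s \<omega> \<le> comp2 T t \<omega>)"
proof -
  have "AE \<omega> in M. \<forall>s t. 0 \<le> s \<and> s \<le> t \<longrightarrow>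
        fst (T s \<omega>) \<le> fst (T t \<omega>) \<and> snd (T s \<omega>) \<le> snd (T t \<omega>)"
    using T by (simp add: bivariate_subordinator_def)
  with levy_process_start[OF T_levy] show ?thesis
  proof eventually_elim
    case (elim \<omega>)
    then have "0 \<le> fst (T s \<omega>)" "0 \<le> snd (T s \<omega>)" if "0 \<le> s" for s
      using that by (metis fst_zero order_refl, metis snd_zero order_refl)
    with elim show ?case by (simp add: comp1_def comp2_def)
  qed
qed

definition shared_time :: "real \<Rightarrow> real \<Rightarrow> 'a \<Rightarrow> real" where
  "shared_time s t \<omega> = overlap (comp1 T s \<omega>) (comp2 T s \<omega>) (comp2 T t \<omega>)"

lemma shared_time_measurable [measurable]: "0 \<le> s \<Longrightarrow> s \<le> t \<Longrightarrow> shared_time s t \<in> borel_measurable M"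
  unfolding shared_time_def [abs_def] overlap_def by measurable

lemma AE_shared_time_bounds:
  assumes "0 \<le> s" "s \<le> t"
  shows "AE \<omega> in M. 0 \<le> shared_time s t \<omega> \<and> shared_time s t \<omega> \<le> comp1 T s \<omega> \<and> shared_time s t \<omega> \<le> comp2 T t \<omega> - comp2 T s \<omega>"
  using AE_T_mono
proof eventually_elim
  case (elim \<omega>)
  then show ?case
    using overlap_bounds[of "comp1 T s \<omega>" "comp2 T s \<omega>" "comp2 T t \<omega>"] assms by (auto simp: shared_time_def)
qed

abbreviation (input) "\<psi>1 a \<equiv> char_exponent M X (a, 0)"
abbreviation (input) "\<psi>2 b \<equiv> char_exponent M X (0, b)"
abbreviation (input) "\<psi> a b \<equiv> char_exponent M X (a, b)"

text \<open>\<open>unshared_char\<close> collects the contribution of the times used by only one of the two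
  increments, and \<open>defect\<close> measures by how much the components of \<open>X\<close> fail to be independent over
  a common time span of length \<open>l\<close>.\<close>

definition unshared_char :: "real \<Rightarrow> real \<Rightarrow> real \<Rightarrow> real \<Rightarrow> 'a \<Rightarrow> complex" where
  "unshared_char a b s t \<omega> = exp (of_real (comp1 T s \<omega> - shared_time s t \<omega>) * \<psi>1 a
      + of_real (comp2 T t \<omega> - comp2 T s \<omega> - shared_time s t \<omega>) * \<psi>2 b)"

definition defect :: "real \<Rightarrow> real \<Rightarrow> real \<Rightarrow> complex" where
  "defect a b l = exp (of_real l * \<psi> a b) - exp (of_real l * (\<psi>1 a + \<psi>2 b))"

lemma norm_exp_exponent_le: "0 \<le> r \<Longrightarrow> norm (exp (of_real r * char_exponent M X u)) \<le> 1"
  using Re_char_exponent_le[OF X, of u] by (simp add: mult_nonneg_nonpos)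

text \<open>As \<open>u\<close> sees only the first component and \<open>v\<close> only the second, the increments of the subordinated
  process are increments of \<open>X\<close> over \<open>[0, T\<^sub>1(s)]\<close> and \<open>[T\<^sub>2(s), T\<^sub>2(t)]\<close>.\<close>

lemma subordinate_char:
  fixes u v :: "real \<times> real"
  assumes st: "0 \<le> s" "s \<le> t" and u: "snd u = 0" and v: "fst v = 0"
  shows "(\<integral>\<omega>. cis (u \<bullet> subordinate X T s \<omega> + v \<bullet> (subordinate X T t \<omega> - subordinate X T s \<omega>)) \<partial>M)
    = (\<integral>\<omega>. overlap_char M X u v (comp1 T s \<omega>) (comp2 T s \<omega>) (comp2 T t \<omega>) \<partial>M)"
proof -
  have t: "0 \<le> t" using st by simp
  have paths: "path_of T \<omega> s = T s \<omega>" "path_of T \<omega> t = T t \<omega>" for \<omega>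
    using st by (auto simp: path_of_def)
  have eval [measurable]: "(\<lambda>x. x r) \<in> borel_measurable (path_space :: (real \<Rightarrow> real \<times> real) measure)" if "0 \<le> r" for r
    by (rule measurable_component_singleton) (simp add: that)
  have eval': "(\<lambda>x. fst (x r)) \<in> borel_measurable (path_space :: (real \<Rightarrow> real \<times> real) measure)"
     "(\<lambda>x. snd (x r)) \<in> borel_measurable (path_space :: (real \<Rightarrow> real \<times> real) measure)" if "0 \<le> r" for r
    using eval[OF that] by (auto simp: borel_prod[symmetric])
  have eq: "u \<bullet> X (fst (path_of T \<omega> s)) \<omega> + v \<bullet> (X (snd (path_of T \<omega> t)) \<omega> - X (snd (path_of T \<omega> s)) \<omega>)
      = u \<bullet> subordinate X T s \<omega> + v \<bullet> (subordinate X T t \<omega> - subordinate X T s \<omega>)" for \<omega>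
    using u v by (simp add: paths subordinate_def comp1_def comp2_def inner_prod_def)
  have meas: "(\<lambda>\<omega>. u \<bullet> subordinate X T s \<omega> + v \<bullet> (subordinate X T t \<omega> - subordinate X T s \<omega>)) \<in> borel_measurable M"
    using levy_process_measurable[OF Y st(1)] levy_process_measurable[OF Y t] by simp
  have ord: "AE \<omega> in M. 0 \<le> fst (path_of T \<omega> s) \<and> 0 \<le> snd (path_of T \<omega> s) \<and> snd (path_of T \<omega> s) \<le> snd (path_of T \<omega> t)"
    using AE_T_mono by eventually_elim (use st in \<open>auto simp: paths comp1_def comp2_def\<close>)
  show ?thesis
    using char_at_random_times[OF X TX eval'(1)[OF st(1)] eval'(2)[OF st(1)] eval'(2)[OF t] ord, of u v, unfolded eq, OF meas]
    by (simp add: paths comp1_def comp2_def)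
qed

text \<open>The identity on which everything rests. Independence of the increments of the subordinated process
  makes its joint characteristic function \<open>ov\<close> the product of two marginal ones; independence of
  the increments of \<open>T\<close> makes that product the expectation of \<open>base\<close>, in which the overlap of the
  two time intervals is ignored. The integrand is the difference of \<open>ov\<close> and \<open>base\<close>.\<close>

lemma expectation_defect_eq_0:
  assumes st: "0 \<le> s" "s \<le> t"
  shows "integrable M (\<lambda>\<omega>. defect a b (shared_time s t \<omega>) * unshared_char a b s t \<omega>)"
    and "(\<integral>\<omega>. defect a b (shared_time s t \<omega>) * unshared_char a b s t \<omega> \<partial>M) = 0"
proof -
  let ?u = "(a, 0) :: real \<times> real" and ?v = "(0, b) :: real \<times> real"
  let ?Y = "subordinate X T"
  define base where "base \<omega> = exp (of_real (comp1 T s \<omega>) * \<psi>1 a) * exp (of_real (comp2 T t \<omega> - comp2 T s \<omega>) * \<psi>2 b)" for \<omega>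
  define ov where "ov \<omega> = overlap_char M X ?u ?v (comp1 T s \<omega>) (comp2 T s \<omega>) (comp2 T t \<omega>)" for \<omega>
  have meas: "comp1 T s \<in> borel_measurable M" "comp2 T s \<in> borel_measurable M" "comp2 T t \<in> borel_measurable M"
    using st by (auto intro: comp_measurable)
  have Lm: "shared_time s t \<in> borel_measurable M" using st by simp
  have "(\<integral>\<omega>. ov \<omega> \<partial>M) = (\<integral>\<omega>. cis (?u \<bullet> ?Y s \<omega> + ?v \<bullet> (?Y t \<omega> - ?Y s \<omega>)) \<partial>M)"
    unfolding ov_def by (rule subordinate_char[symmetric]) (use st in auto)
  also have "\<dots> = (\<integral>\<omega>. cis (?u \<bullet> ?Y s \<omega>) * cis (?v \<bullet> (?Y t \<omega> - ?Y s \<omega>)) \<partial>M)"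
    by (simp only: cis_mult)
  also have "\<dots> = (\<integral>\<omega>. cis (?u \<bullet> ?Y s \<omega>) \<partial>M) * (\<integral>\<omega>. cis (?v \<bullet> (?Y t \<omega> - ?Y s \<omega>)) \<partial>M)"
    by (rule levy_process_integral_mult[OF Y st, where f = "\<lambda>x. cis (?u \<bullet> x)" and g = "\<lambda>x. cis (?v \<bullet> x)"]) simp_all
  also have "(\<integral>\<omega>. cis (?u \<bullet> ?Y s \<omega>) \<partial>M) = (\<integral>\<omega>. exp (of_real (comp1 T s \<omega>) * \<psi>1 a) \<partial>M)"
  proof -
    have "(\<integral>\<omega>. cis (?u \<bullet> ?Y s \<omega>) \<partial>M) = (\<integral>\<omega>. overlap_char M X ?u 0 (comp1 T s \<omega>) (comp2 T s \<omega>) (comp2 T t \<omega>) \<partial>M)"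
      using subordinate_char[OF st, of ?u 0] by simp
    then show ?thesis
      by (simp add: overlap_char_def char_exponent_zero[OF X] algebra_simps)
  qed
  also have "(\<integral>\<omega>. cis (?v \<bullet> (?Y t \<omega> - ?Y s \<omega>)) \<partial>M) = (\<integral>\<omega>. exp (of_real (comp2 T t \<omega> - comp2 T s \<omega>) * \<psi>2 b) \<partial>M)"
  proof -
    have "(\<integral>\<omega>. cis (?v \<bullet> (?Y t \<omega> - ?Y s \<omega>)) \<partial>M) = (\<integral>\<omega>. overlap_char M X 0 ?v (comp1 T s \<omega>) (comp2 T s \<omega>) (comp2 T t \<omega>) \<partial>M)"
      using subordinate_char[OF st, of 0 ?v] by simp
    then show ?thesis
      by (simp add: overlap_char_def char_exponent_zero[OF X] algebra_simps)
  qed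
  also have "(\<integral>\<omega>. exp (of_real (comp1 T s \<omega>) * \<psi>1 a) \<partial>M) * (\<integral>\<omega>. exp (of_real (comp2 T t \<omega> - comp2 T s \<omega>) * \<psi>2 b) \<partial>M)
      = (\<integral>\<omega>. base \<omega> \<partial>M)"
  proof -
    \<comment> \<open>The maximum with \<open>0\<close> changes nothing almost surely and makes the functions bounded by \<open>1\<close>.\<close>
    define f where "f x = exp (of_real (max 0 (fst x)) * \<psi>1 a)" for x :: "real \<times> real"
    define g where "g x = exp (of_real (max 0 (snd x)) * \<psi>2 b)" for x :: "real \<times> real"
    have fg: "f \<in> borel_measurable borel" "g \<in> borel_measurable borel"
      unfolding f_def [abs_def] g_def [abs_def]
      by (intro borel_measurable_continuous_onI continuous_intros)+
    have AE: "AE \<omega> in M. f (T s \<omega>) = exp (of_real (comp1 T s \<omega>) * \<psi>1 a) \<and>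
        g (T t \<omega> - T s \<omega>) = exp (of_real (comp2 T t \<omega> - comp2 T s \<omega>) * \<psi>2 b)"
      using AE_T_mono by eventually_elim (use st in \<open>auto simp: f_def g_def comp1_def comp2_def\<close>)
    have fgm: "(\<lambda>\<omega>. f (T s \<omega>)) \<in> borel_measurable M" "(\<lambda>\<omega>. g (T t \<omega> - T s \<omega>)) \<in> borel_measurable M"
      using st by (auto intro!: measurable_compose[OF _ fg(1)] measurable_compose[OF _ fg(2)])
    have expm: "(\<lambda>\<omega>. exp (of_real (comp1 T s \<omega>) * \<psi>1 a)) \<in> borel_measurable M"
      "(\<lambda>\<omega>. exp (of_real (comp2 T t \<omega> - comp2 T s \<omega>) * \<psi>2 b)) \<in> borel_measurable M"
      using meas by simp_all
    have "(\<integral>\<omega>. f (T s \<omega>) * g (T t \<omega> - T s \<omega>) \<partial>M) = (\<integral>\<omega>. f (T s \<omega>) \<partial>M) * (\<integral>\<omega>. g (T t \<omega> - T s \<omega>) \<partial>M)"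
      by (rule levy_process_integral_mult[OF T_levy st fg])
        (auto simp: f_def g_def simp del: norm_exp_eq_Re intro!: norm_exp_exponent_le)
    moreover have "(\<integral>\<omega>. f (T s \<omega>) \<partial>M) = (\<integral>\<omega>. exp (of_real (comp1 T s \<omega>) * \<psi>1 a) \<partial>M)"
      using AE fgm expm by (intro integral_cong_AE) auto
    moreover have "(\<integral>\<omega>. g (T t \<omega> - T s \<omega>) \<partial>M) = (\<integral>\<omega>. exp (of_real (comp2 T t \<omega> - comp2 T s \<omega>) * \<psi>2 b) \<partial>M)"
      using AE fgm expm by (intro integral_cong_AE) auto
    moreover have "(\<integral>\<omega>. f (T s \<omega>) * g (T t \<omega> - T s \<omega>) \<partial>M) = (\<integral>\<omega>. base \<omega> \<partial>M)"
      unfolding base_def using AE fgm expm by (intro integral_cong_AE borel_measurable_times) auto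
    ultimately show ?thesis by simp
  qed
  finally have eq: "(\<integral>\<omega>. ov \<omega> \<partial>M) = (\<integral>\<omega>. base \<omega> \<partial>M)" .
  have split: "ov \<omega> - base \<omega> = defect a b (shared_time s t \<omega>) * unshared_char a b s t \<omega>" for \<omega>
    unfolding ov_def base_def defect_def unshared_char_def overlap_char_def shared_time_def [symmetric]
    by (simp add: left_diff_distrib algebra_simps flip: exp_add)
  have int_base: "integrable M base"
  proof (rule integrable_const_bound[where B = 1])
    show "AE \<omega> in M. norm (base \<omega>) \<le> 1"
      using AE_T_mono
    proof eventually_elim
      case (elim \<omega>)
      then show ?case
        unfolding base_def norm_mult using st
        by (intro mult_le_one norm_exp_exponent_le norm_ge_zero) auto
    qed
    show "base \<in> borel_measurable M" unfolding base_def [abs_def] using meas by simp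
  qed
  have int_ov: "integrable M ov"
  proof (rule integrable_const_bound[where B = 1])
    show "AE \<omega> in M. norm (ov \<omega>) \<le> 1"
      using AE_shared_time_bounds[OF st]
    proof eventually_elim
      case (elim \<omega>)
      then show ?case
        unfolding ov_def overlap_char_def exp_add norm_mult shared_time_def [symmetric]
        by (intro mult_le_one norm_exp_exponent_le mult_nonneg_nonneg norm_ge_zero) auto
    qed
    show "ov \<in> borel_measurable M" unfolding ov_def [abs_def] overlap_char_def shared_time_def [symmetric] using meas Lm by simp
  qed
  show "integrable M (\<lambda>\<omega>. defect a b (shared_time s t \<omega>) * unshared_char a b s t \<omega>)"
    using Bochner_Integration.integrable_diff[OF int_ov int_base] unfolding split .
  show "(\<integral>\<omega>. defect a b (shared_time s t \<omega>) * unshared_char a b s t \<omega> \<partial>M) = 0"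
    using Bochner_Integration.integral_diff[OF int_ov int_base] unfolding split eq by simp
qed

end

section \<open>The overlap vanishes: real exponents and deterministic time changes\<close>

lemma levy_process_AE_increment:
  assumes X: "levy_process M X" and st: "0 \<le> s" "s \<le> t"
    and P: "{x. P x} \<in> sets borel"
  shows "(AE \<omega> in M. P (X t \<omega> - X s \<omega>)) \<longleftrightarrow> (AE \<omega> in M. P (X (t - s) \<omega>))"
proof -
  have m: "X t \<in> borel_measurable M" "X s \<in> borel_measurable M" "X (t - s) \<in> borel_measurable M"
    using X st by (auto intro: levy_process_measurable)
  have "(AE \<omega> in M. P (X t \<omega> - X s \<omega>)) \<longleftrightarrow> (AE x in distr M borel (\<lambda>\<omega>. X t \<omega> - X s \<omega>). P x)"
    using m P by (subst AE_distr_iff) auto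
  also have "\<dots> \<longleftrightarrow> (AE \<omega> in M. P (X (t - s) \<omega>))"
    unfolding levy_process_stationary[OF X st] using m P by (subst AE_distr_iff) auto
  finally show ?thesis .
qed

context subordinated_levy
begin

lemma borel_snd_zero: "{x :: real \<times> real. snd x = 0} \<in> sets borel"
  by (intro borel_closed closed_Collect_eq continuous_intros)

text \<open>If the second component stands still up to time \<open>h\<close>, stationarity lets it stand still on each
  interval \<open>[n h, (n + 1) h]\<close>.\<close>

lemma comp2_null_if_zero_once:
  assumes h: "h > 0" and zero: "AE \<omega> in M. comp2 T h \<omega> = 0"
  shows "indistinguishable M (comp2 T) (\<lambda>t \<omega>. 0)"
proof -
  have "AE \<omega> in M. comp2 T (real n * h) \<omega> = 0" for n
  proof (induction n)
    case 0
    show ?case using AE_T_mono by eventually_elim (simp add: comp2_def)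
  next
    case (Suc n)
    have "AE \<omega> in M. snd (T (real (Suc n) * h) \<omega> - T (real n * h) \<omega>) = 0"
      by (subst levy_process_AE_increment[OF T_levy _ _ borel_snd_zero])
        (use h zero in \<open>simp_all add: comp2_def algebra_simps\<close>)
    with Suc.IH show ?case
      by eventually_elim (simp add: comp2_def)
  qed
  then have "AE \<omega> in M. \<forall>n. comp2 T (real n * h) \<omega> = 0"
    by (simp add: AE_all_countable)
  with AE_T_mono show ?thesis
    unfolding indistinguishable_def
  proof eventually_elim
    case (elim \<omega>)
    show ?case
    proof (intro allI impI)
      fix t :: real assume "0 \<le> t"
      obtain n :: nat where "t / h \<le> real n" using real_arch_simple by blast
      then have "t \<le> real n * h" using h by (simp add: field_simps)
      then have "0 \<le> comp2 T t \<omega>" "comp2 T t \<omega> \<le> comp2 T (real n * h) \<omega>"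
        using elim(1) \<open>0 \<le> t\<close> by blast+
      then show "comp2 T t \<omega> = 0" using elim(2) by (metis order_antisym)
    qed
  qed
qed

text \<open>Where \<open>T\<^sub>2(s) < T\<^sub>1(s)\<close>, a vanishing overlap forces \<open>T\<^sub>2(t) = T\<^sub>2(s)\<close>. The two events are
  independent, so if the first one, \<open>A\<close>, had positive probability, the second one, \<open>B\<close>, would be
  almost sure, and the second component would be null.\<close>

lemma comp1_le_comp2_if_no_overlap:
  assumes st: "0 \<le> s" "s < t" and L0: "AE \<omega> in M. shared_time s t \<omega> = 0"
    and nonnull: "\<not> indistinguishable M (comp2 T) (\<lambda>t \<omega>. 0)"
  shows "AE \<omega> in M. comp1 T s \<omega> \<le> comp2 T s \<omega>"
proof -
  define f :: "real \<times> real \<Rightarrow> complex" where "f = indicator {x. snd x < fst x}"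
  define g :: "real \<times> real \<Rightarrow> complex" where "g = indicator {x. snd x = 0}"
  have sets: "{x :: real \<times> real. snd x < fst x} \<in> sets borel"
    by (intro borel_open open_Collect_less continuous_intros)
  have f: "f \<in> borel_measurable borel" and g: "g \<in> borel_measurable borel"
    unfolding f_def g_def using sets borel_snd_zero by simp_all
  have bound: "norm (f x) \<le> 1" "norm (g x) \<le> 1" for x
    by (simp_all add: f_def g_def indicator_def)
  have st': "s \<le> t" using st by simp
  define A where "A = {\<omega>\<in>space M. comp2 T s \<omega> < comp1 T s \<omega>}"
  define B where "B = {\<omega>\<in>space M. comp2 T t \<omega> = comp2 T s \<omega>}"
  have meas: "comp1 T s \<in> borel_measurable M" "comp2 T s \<in> borel_measurable M" "comp2 T t \<in> borel_measurable M"
    using st by (auto intro: comp_measurable)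
  have AB [measurable]: "A \<in> events" "B \<in> events"
    unfolding A_def B_def using meas by measurable
  have "(\<integral>\<omega>. indicator A \<omega> * indicator B \<omega> \<partial>M) = (\<integral>\<omega>. f (T s \<omega>) * g (T t \<omega> - T s \<omega>) \<partial>M)"
    by (intro Bochner_Integration.integral_cong refl)
      (auto simp: f_def g_def A_def B_def comp1_def comp2_def indicator_def)
  also have "\<dots> = (\<integral>\<omega>. f (T s \<omega>) \<partial>M) * (\<integral>\<omega>. g (T t \<omega> - T s \<omega>) \<partial>M)"
    by (rule levy_process_integral_mult[OF T_levy st(1) st' f g bound])
  also have "(\<integral>\<omega>. f (T s \<omega>) \<partial>M) = (\<integral>\<omega>. indicator A \<omega> \<partial>M)"
    by (intro Bochner_Integration.integral_cong refl)
      (auto simp: f_def A_def comp1_def comp2_def indicator_def)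
  also have "(\<integral>\<omega>. g (T t \<omega> - T s \<omega>) \<partial>M) = (\<integral>\<omega>. indicator B \<omega> \<partial>M)"
    by (intro Bochner_Integration.integral_cong refl)
      (auto simp: g_def B_def comp1_def comp2_def indicator_def)
  finally have "(\<integral>\<omega>. indicator (A \<inter> B) \<omega> \<partial>M) = (\<integral>\<omega>. indicator A \<omega> \<partial>M) * (\<integral>\<omega>. indicator B \<omega> \<partial>M :: complex)"
    by (simp add: indicator_inter_arith)
  moreover have "(\<integral>\<omega>. (indicator E \<omega> :: complex) \<partial>M) = of_real (prob E)" if "E \<in> events" for E
  proof -
    have "(\<integral>\<omega>. (indicator E \<omega> :: complex) \<partial>M) = (\<integral>\<omega>. of_real (indicator E \<omega>) \<partial>M)"
      by (intro Bochner_Integration.integral_cong refl) (simp add: indicator_def)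
    also have "\<dots> = of_real (\<integral>\<omega>. indicator E \<omega> \<partial>M)"
      by (rule integral_complex_of_real)
    finally show ?thesis using that by simp
  qed
  ultimately have "complex_of_real (prob (A \<inter> B)) = of_real (prob A * prob B)"
    using AB sets.Int[OF AB] by simp
  then have indep: "prob (A \<inter> B) = prob A * prob B"
    by (simp only: of_real_eq_iff)
  have "prob (A \<inter> B) = prob A"
  proof (rule finite_measure_eq_AE)
    show "AE \<omega> in M. \<omega> \<in> A \<inter> B \<longleftrightarrow> \<omega> \<in> A"
      using L0 AE_T_mono
    proof eventually_elim
      case (elim \<omega>)
      then have "comp2 T s \<omega> \<le> comp2 T t \<omega>" using st by simp
      with elim(1) show ?case
        by (auto simp: A_def B_def shared_time_def overlap_def max_def min_def split: if_splits)
    qed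
  qed (use AB in auto)
  with indep have *: "prob A = 0 \<or> prob B = 1" by auto
  have "prob B \<noteq> 1"
  proof
    assume "prob B = 1"
    then have "AE \<omega> in M. \<omega> \<in> B" by (rule prob_eq_1[OF AB(2), THEN iffD1])
    then have "AE \<omega> in M. snd (T t \<omega> - T s \<omega>) = 0"
      by eventually_elim (simp add: B_def comp2_def)
    then have "AE \<omega> in M. snd (T (t - s) \<omega>) = 0"
      by (subst (asm) levy_process_AE_increment[OF T_levy st(1) st' borel_snd_zero])
    then show False
      using comp2_null_if_zero_once[of "t - s"] nonnull st by (simp add: comp2_def)
  qed
  with * have "prob A = 0" by simp
  then have "AE \<omega> in M. \<omega> \<notin> A" by (simp add: prob_eq_0[OF AB(1)])
  with AE_space show ?thesis
    by eventually_elim (auto simp: A_def not_less)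
qed

text \<open>With real exponents the integrand of \<open>expectation_defect_eq_0\<close> is a positive factor times
  \<open>exp (l * p) - exp (l * q)\<close> with \<open>p \<noteq> q\<close>, whose sign for \<open>l > 0\<close> is that of \<open>p - q\<close>.\<close>

lemma no_overlap_symmetric_case:
  assumes st: "0 \<le> s" "s \<le> t"
    and real: "Im (\<psi>1 a) = 0" "Im (\<psi>2 b) = 0" "Im (\<psi> a b) = 0"
    and neq: "\<psi> a b \<noteq> \<psi>1 a + \<psi>2 b"
  shows "AE \<omega> in M. shared_time s t \<omega> = 0"
proof -
  define p q where "p = Re (\<psi> a b)" "q = Re (\<psi>1 a + \<psi>2 b)"
  have pq: "\<psi> a b = of_real p" "\<psi>1 a + \<psi>2 b = of_real q" "p \<noteq> q"
    using real neq by (auto simp: p_q_def complex_eq_iff)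
  have \<psi>12: "\<psi>1 a = of_real (Re (\<psi>1 a))" "\<psi>2 b = of_real (Re (\<psi>2 b))"
    using real by (auto simp: complex_eq_iff)
  define R where "R \<omega> = exp ((comp1 T s \<omega> - shared_time s t \<omega>) * Re (\<psi>1 a) + (comp2 T t \<omega> - comp2 T s \<omega> - shared_time s t \<omega>) * Re (\<psi>2 b))" for \<omega>
  define F where "F \<omega> = (exp (shared_time s t \<omega> * p) - exp (shared_time s t \<omega> * q)) * R \<omega>" for \<omega>
  have F: "defect a b (shared_time s t \<omega>) * unshared_char a b s t \<omega> = of_real (F \<omega>)" for \<omega>
    unfolding defect_def unshared_char_def F_def R_def pq
    by (subst \<psi>12(1), subst \<psi>12(2)) (simp flip: exp_of_real)
  have int: "integrable M F" and F0: "(\<integral>\<omega>. F \<omega> \<partial>M) = 0"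
    using expectation_defect_eq_0[OF st, of a b] unfolding F
    by (simp_all add: complex_of_real_integrable_eq)
  define \<sigma> where "\<sigma> = sgn (p - q)"
  have sign: "\<sigma> * (exp (l * p) - exp (l * q)) \<ge> 0 \<and> (\<sigma> * (exp (l * p) - exp (l * q)) = 0 \<longrightarrow> l = 0)" if "0 \<le> l" for l
  proof (cases "l = 0")
    case False
    with that have "0 < l" by simp
    then show ?thesis
      using pq(3) by (cases "p < q") (auto simp: \<sigma>_def)
  qed simp
  have "AE \<omega> in M. 0 \<le> \<sigma> * F \<omega> \<and> (\<sigma> * F \<omega> = 0 \<longrightarrow> shared_time s t \<omega> = 0)"
    using AE_shared_time_bounds[OF st]
  proof eventually_elim
    case (elim \<omega>)
    have "\<sigma> * F \<omega> = (\<sigma> * (exp (shared_time s t \<omega> * p) - exp (shared_time s t \<omega> * q))) * R \<omega>"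
      by (simp add: F_def)
    moreover have "R \<omega> > 0" by (simp add: R_def)
    moreover have "0 \<le> \<sigma> * (exp (shared_time s t \<omega> * p) - exp (shared_time s t \<omega> * q))"
        "\<sigma> * (exp (shared_time s t \<omega> * p) - exp (shared_time s t \<omega> * q)) = 0 \<Longrightarrow> shared_time s t \<omega> = 0"
      using sign[of "shared_time s t \<omega>"] elim by blast+
    ultimately show ?case
      by (metis mult_nonneg_nonneg less_imp_le mult_eq_0_iff less_irrefl)
  qed
  moreover have "AE \<omega> in M. \<sigma> * F \<omega> = 0"
    using int F0 calculation by (subst integral_nonneg_eq_0_iff_AE[symmetric]) auto
  ultimately show ?thesis by eventually_elim simp
qed

text \<open>The integrand is now a constant, so \<open>l\<close> times the difference of the exponents is a multiple of
  \<open>2\<pi>\<i>\<close>; as \<open>l \<le> \<gamma> - \<beta>\<close>, the bound \<open>small\<close> leaves only the multiple \<open>0\<close>.\<close>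

lemma no_overlap_deterministic_case:
  assumes st: "0 \<le> s" "s \<le> t"
    and det: "AE \<omega> in M. comp1 T s \<omega> = \<alpha> \<and> comp2 T s \<omega> = \<beta> \<and> comp2 T t \<omega> = \<gamma>"
    and small: "(\<gamma> - \<beta>) * norm (\<psi> a b - (\<psi>1 a + \<psi>2 b)) < 2 * pi"
    and neq: "\<psi> a b \<noteq> \<psi>1 a + \<psi>2 b"
  shows "AE \<omega> in M. shared_time s t \<omega> = 0"
proof -
  define l where "l = overlap \<alpha> \<beta> \<gamma>"
  define r where "r = exp (of_real (\<alpha> - l) * \<psi>1 a + of_real (\<gamma> - \<beta> - l) * \<psi>2 b)"
  have AE_l: "AE \<omega> in M. shared_time s t \<omega> = l"
    using det by eventually_elim (simp add: shared_time_def l_def)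
  have AE_r: "AE \<omega> in M. defect a b (shared_time s t \<omega>) * unshared_char a b s t \<omega> = defect a b l * r"
    using det by eventually_elim (simp add: unshared_char_def shared_time_def l_def r_def)
  have "AE \<omega> in M. 0 \<le> l \<and> l \<le> \<gamma> - \<beta>"
    using AE_l AE_shared_time_bounds[OF st] det by eventually_elim auto
  then have l: "0 \<le> l" "l \<le> \<gamma> - \<beta>" by (auto simp: AE_const)
  have "(\<integral>\<omega>. defect a b (shared_time s t \<omega>) * unshared_char a b s t \<omega> \<partial>M) = (\<integral>\<omega>. defect a b l * r \<partial>M)"
    using expectation_defect_eq_0(1)[OF st, of a b] AE_r by (intro integral_cong_AE) auto
  then have "defect a b l * r = 0"
    using expectation_defect_eq_0(2)[OF st, of a b] by (simp add: prob_space)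
  then have "exp (of_real l * \<psi> a b) = exp (of_real l * (\<psi>1 a + \<psi>2 b))"
    by (simp add: r_def defect_def)
  then have "exp (of_real l * (\<psi> a b - (\<psi>1 a + \<psi>2 b))) = 1"
    by (simp add: right_diff_distrib exp_diff)
  moreover have "norm (of_real l * (\<psi> a b - (\<psi>1 a + \<psi>2 b))) < 2 * pi"
    using l small mult_right_mono[OF l(2) norm_ge_zero[of "\<psi> a b - (\<psi>1 a + \<psi>2 b)"]]
    by (simp add: norm_mult)
  ultimately have "of_real l * (\<psi> a b - (\<psi>1 a + \<psi>2 b)) = 0"
    by (rule exp_eq_1_imp_zero)
  then have "l = 0" using neq by simp
  then show ?thesis using AE_l by simp
qed

end

section \<open>The overlap vanishes: correlated components\<close>

text \<open>The entire function \<open>(exp z - 1) / z\<close>; the value at the removable singularity avoids a case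
  distinction when \<open>z\<close> runs through a sequence tending to \<open>0\<close>.\<close>

definition expm1_quotient :: "complex \<Rightarrow> complex" where
  "expm1_quotient z = (if z = 0 then 1 else (exp z - 1) / z)"

lemma expm1_quotient_mult: "exp z - 1 = z * expm1_quotient z"
  by (simp add: expm1_quotient_def)

lemma tendsto_expm1_quotient:
  assumes "(w \<longlongrightarrow> 0) F"
  shows "((\<lambda>n. expm1_quotient (w n)) \<longlongrightarrow> 1) F"
proof -
  have "(exp has_field_derivative 1) (at (0::complex))"
    using DERIV_exp[of "0::complex"] by simp
  then have "((\<lambda>z. (exp z - 1) / z) \<longlongrightarrow> 1) (at (0::complex))"
    by (simp add: DERIV_def)
  moreover have "\<forall>\<^sub>F z in at 0. (exp z - 1) / z = expm1_quotient z"
    by (simp add: expm1_quotient_def eventually_at_filter)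
  ultimately have "(expm1_quotient \<longlongrightarrow> 1) (at 0)"
    by (rule Lim_transform_eventually)
  then have "isCont expm1_quotient 0"
    by (simp add: isCont_def expm1_quotient_def [of 0])
  from isCont_tendsto_compose[OF this assms] show ?thesis
    by (simp add: expm1_quotient_def [of 0])
qed

context subordinated_levy
begin

lemma tendsto_process_char_at_zero:
  assumes h: "h \<longlonglongrightarrow> 0" and "0 \<le> t"
  shows "(\<lambda>n. process_char M X t (h n *\<^sub>R u)) \<longlonglongrightarrow> 1"
proof -
  have [measurable]: "X t \<in> borel_measurable M"
    using X \<open>0 \<le> t\<close> by (rule levy_process_measurable)
  have "(\<lambda>n. \<integral>\<omega>. cis ((h n *\<^sub>R u) \<bullet> X t \<omega>) \<partial>M) \<longlonglongrightarrow> (\<integral>\<omega>. 1 \<partial>M)"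
  proof (rule integral_dominated_convergence[where w = "\<lambda>_. 1"])
    have "(\<lambda>n. cis ((h n *\<^sub>R u) \<bullet> X t \<omega>)) \<longlonglongrightarrow> cis ((0 *\<^sub>R u) \<bullet> X t \<omega>)" for \<omega>
      by (intro tendsto_intros h)
    then show "AE \<omega> in M. (\<lambda>n. cis ((h n *\<^sub>R u) \<bullet> X t \<omega>)) \<longlonglongrightarrow> 1" by simp
  qed simp_all
  then show ?thesis by (simp add: process_char_def prob_space)
qed

text \<open>That the characteristic functions tend to \<open>1\<close> determines the limit of the exponents only up to
  multiples of \<open>2\<pi>\<i>\<close>. Using all times in \<open>[0, 1]\<close> removes the ambiguity: \<open>exp z - 1\<close> is \<open>z\<close> times
  the integral \<open>I\<close> of \<open>exp (t z)\<close> over \<open>[0, 1]\<close>, and \<open>I\<close> tends to \<open>1\<close>.\<close>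

lemma tendsto_char_exponent_zero:
  assumes h: "h \<longlonglongrightarrow> 0"
  shows "(\<lambda>n. char_exponent M X (h n *\<^sub>R u)) \<longlonglongrightarrow> 0"
proof -
  define z where "z n = char_exponent M X (h n *\<^sub>R u)" for n
  define I where "I n = integral {0..1} (\<lambda>t. exp (of_real t * z n))" for n
  have lim: "(\<lambda>n. exp (of_real t * z n)) \<longlonglongrightarrow> 1" if "0 \<le> t" for t
    using tendsto_process_char_at_zero[OF h that, of u] process_char_eq_exp[OF X that] by (simp add: z_def)
  have I: "I \<longlonglongrightarrow> integral {0..1::real} (\<lambda>t. 1 :: complex)"
    unfolding I_def [abs_def]
  proof (rule dominated_convergence(2)[where h = "\<lambda>_. 1"])
    show "(\<lambda>t. exp (of_real t * z n)) integrable_on {0..1}" for n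
      by (intro integrable_continuous_interval continuous_intros)
    show "norm (exp (of_real t * z n)) \<le> 1" if "t \<in> {0..1}" for t n
      using that unfolding z_def by (intro norm_exp_exponent_le) simp
  qed (use lim in auto)
  have eq: "z n * I n = exp (z n) - 1" for n
  proof -
    have "((\<lambda>t. z n * exp (of_real t * z n)) has_integral (exp (of_real 1 * z n) - exp (of_real 0 * z n))) {0..1}"
    proof (rule fundamental_theorem_of_calculus)
      fix t :: real
      have "((\<lambda>w. exp (w * z n)) has_field_derivative z n * exp (of_real t * z n)) (at (of_real t))"
        by (auto intro!: derivative_eq_intros)
      from has_vector_derivative_real_field[OF this]
      show "((\<lambda>t. exp (of_real t * z n)) has_vector_derivative z n * exp (of_real t * z n)) (at t within {0..1})" .
    qed simp
    from integral_unique[OF this] show ?thesis by (simp add: I_def)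
  qed
  have "(\<lambda>n. exp (z n) - 1) \<longlonglongrightarrow> 1 - 1"
    using lim[of 1] by (intro tendsto_intros) simp
  then have "(\<lambda>n. (exp (z n) - 1) / I n) \<longlonglongrightarrow> 0 / 1"
    using I by (intro tendsto_divide) simp_all
  moreover have "\<forall>\<^sub>F n in sequentially. (exp (z n) - 1) / I n = z n"
  proof -
    have "I \<longlonglongrightarrow> 1" using I by simp
    then have "\<forall>\<^sub>F n in sequentially. I n \<noteq> 0"
      by (rule tendsto_imp_eventually_ne) simp
    then show ?thesis by eventually_elim (simp flip: eq)
  qed
  ultimately show ?thesis
    unfolding z_def [symmetric] by (simp add: tendsto_cong)
qed

text \<open>Since \<open>cis (h U) = 1 + h D(U)\<close> with difference quotients \<open>D(U)\<close> tending to \<open>\<i> U\<close>, the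
  expression is exactly the covariance of \<open>D(U)\<close> and \<open>D(V)\<close>, and \<open>|D(x)| \<le> |x|\<close> supplies the
  integrable bounds.\<close>

lemma tendsto_covariance_cis:
  fixes U V :: "'a \<Rightarrow> real"
  assumes [measurable]: "U \<in> borel_measurable M" "V \<in> borel_measurable M"
    and U2: "integrable M (\<lambda>\<omega>. (U \<omega>)\<^sup>2)" and V2: "integrable M (\<lambda>\<omega>. (V \<omega>)\<^sup>2)"
    and h: "h \<longlonglongrightarrow> 0" and h0: "\<And>n. h n \<noteq> 0"
  shows "(\<lambda>n. ((\<integral>\<omega>. cis (h n * U \<omega>) * cis (h n * V \<omega>) \<partial>M)
        - (\<integral>\<omega>. cis (h n * U \<omega>) \<partial>M) * (\<integral>\<omega>. cis (h n * V \<omega>) \<partial>M)) / of_real ((h n)\<^sup>2))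
      \<longlonglongrightarrow> - of_real (covariance M U V)"
proof -
  have intU: "integrable M U" and intV: "integrable M V"
    using square_integrable_imp_integrable[of U] square_integrable_imp_integrable[of V] U2 V2 by auto
  have intUV: "integrable M (\<lambda>\<omega>. U \<omega> * V \<omega>)"
  proof (rule Bochner_Integration.integrable_bound[OF Bochner_Integration.integrable_add[OF U2 V2]])
    have "norm (x * y) \<le> norm (x\<^sup>2 + y\<^sup>2)" for x y :: real
    proof -
      have "2 * (\<bar>x\<bar> * \<bar>y\<bar>) \<le> x\<^sup>2 + y\<^sup>2"
        using sum_squares_bound[of "\<bar>x\<bar>" "\<bar>y\<bar>"] by (simp add: mult.assoc)
      moreover have "0 \<le> \<bar>x\<bar> * \<bar>y\<bar>" by simp
      moreover have "norm (x * y) = \<bar>x\<bar> * \<bar>y\<bar>" "norm (x\<^sup>2 + y\<^sup>2) = x\<^sup>2 + y\<^sup>2"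
        by (simp_all add: abs_mult)
      ultimately show ?thesis by linarith
    qed
    then show "AE \<omega> in M. norm (U \<omega> * V \<omega>) \<le> norm ((U \<omega>)\<^sup>2 + (V \<omega>)\<^sup>2)" by simp
  qed simp
  define D where "D n x = (cis (h n * x) - 1) / of_real (h n)" for n and x :: real
  have D_lim: "(\<lambda>n. D n x) \<longlonglongrightarrow> \<i> * of_real x" for x
  proof -
    have "((\<lambda>w. exp (\<i> * of_real x * w)) has_field_derivative \<i> * of_real x) (at 0)"
      by (auto intro!: derivative_eq_intros)
    then have "((\<lambda>w. (exp (\<i> * of_real x * w) - 1) / w) \<longlongrightarrow> \<i> * of_real x) (at 0)"
      by (simp add: DERIV_def)
    moreover have "filterlim (\<lambda>n. complex_of_real (h n)) (at 0) sequentially"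
      unfolding filterlim_at using tendsto_of_real[OF h, where 'a = complex] h0 by simp
    ultimately have "(\<lambda>n. (exp (\<i> * of_real x * of_real (h n)) - 1) / of_real (h n)) \<longlonglongrightarrow> \<i> * of_real x"
      by (rule filterlim_compose)
    then show ?thesis
      by (simp add: D_def cis_conv_exp mult_ac)
  qed
  have D_bound: "norm (D n x) \<le> \<bar>x\<bar>" for n x
  proof -
    have "norm (cis (h n * x) - 1) \<le> \<bar>h n * x\<bar>"
      using iexp_approx1[of "h n * x" 0] by (simp add: cis_conv_exp)
    then show ?thesis
      using h0[of n] by (simp add: D_def norm_divide abs_mult field_simps)
  qed
  have D_bound2: "norm (D n x * D n y) \<le> \<bar>x * y\<bar>" for n x y
    unfolding norm_mult abs_mult by (intro mult_mono D_bound) simp_all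
  have [measurable]: "D n \<in> borel_measurable borel" for n
    unfolding D_def by measurable
  have intD: "integrable M (\<lambda>\<omega>. D n (U \<omega>))" "integrable M (\<lambda>\<omega>. D n (V \<omega>))"
      "integrable M (\<lambda>\<omega>. D n (U \<omega>) * D n (V \<omega>))" for n
    by (rule Bochner_Integration.integrable_bound[OF intU], simp_all add: D_bound)
      (rule Bochner_Integration.integrable_bound[OF intV], simp_all add: D_bound,
       rule Bochner_Integration.integrable_bound[OF intUV], simp_all add: D_bound2)
  have "(\<lambda>n. \<integral>\<omega>. D n (U \<omega>) \<partial>M) \<longlonglongrightarrow> (\<integral>\<omega>. \<i> * of_real (U \<omega>) \<partial>M)"
    by (rule integral_dominated_convergence[where w = "\<lambda>\<omega>. \<bar>U \<omega>\<bar>"])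
      (use intU in \<open>simp_all add: D_lim D_bound\<close>)
  moreover have "(\<lambda>n. \<integral>\<omega>. D n (V \<omega>) \<partial>M) \<longlonglongrightarrow> (\<integral>\<omega>. \<i> * of_real (V \<omega>) \<partial>M)"
    by (rule integral_dominated_convergence[where w = "\<lambda>\<omega>. \<bar>V \<omega>\<bar>"])
      (use intV in \<open>simp_all add: D_lim D_bound\<close>)
  moreover have "(\<lambda>n. \<integral>\<omega>. D n (U \<omega>) * D n (V \<omega>) \<partial>M) \<longlonglongrightarrow> (\<integral>\<omega>. (\<i> * of_real (U \<omega>)) * (\<i> * of_real (V \<omega>)) \<partial>M)"
    by (rule integral_dominated_convergence[where w = "\<lambda>\<omega>. \<bar>U \<omega> * V \<omega>\<bar>"])
      (use intUV in \<open>simp_all add: D_bound2 tendsto_mult[OF D_lim D_lim] del: abs_mult\<close>)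
  ultimately have "(\<lambda>n. (\<integral>\<omega>. D n (U \<omega>) * D n (V \<omega>) \<partial>M) - (\<integral>\<omega>. D n (U \<omega>) \<partial>M) * (\<integral>\<omega>. D n (V \<omega>) \<partial>M))
     \<longlonglongrightarrow> (\<integral>\<omega>. (\<i> * of_real (U \<omega>)) * (\<i> * of_real (V \<omega>)) \<partial>M) - (\<integral>\<omega>. \<i> * of_real (U \<omega>) \<partial>M) * (\<integral>\<omega>. \<i> * of_real (V \<omega>) \<partial>M)"
    by (intro tendsto_intros)
  also have "(\<integral>\<omega>. (\<i> * of_real (U \<omega>)) * (\<i> * of_real (V \<omega>)) \<partial>M) - (\<integral>\<omega>. \<i> * of_real (U \<omega>) \<partial>M) * (\<integral>\<omega>. \<i> * of_real (V \<omega>) \<partial>M)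
      = - of_real ((\<integral>\<omega>. U \<omega> * V \<omega> \<partial>M) - (\<integral>\<omega>. U \<omega> \<partial>M) * (\<integral>\<omega>. V \<omega> \<partial>M))"
  proof -
    have "(\<integral>\<omega>. (\<i> * of_real (U \<omega>)) * (\<i> * of_real (V \<omega>)) \<partial>M) = (\<integral>\<omega>. - of_real (U \<omega> * V \<omega>) \<partial>M)"
      by (intro Bochner_Integration.integral_cong refl) (simp add: complex_eq_iff)
    also have "\<dots> = - of_real (\<integral>\<omega>. U \<omega> * V \<omega> \<partial>M)"
      by (subst integral_minus) (simp only: integral_complex_of_real)
    finally have "(\<integral>\<omega>. (\<i> * of_real (U \<omega>)) * (\<i> * of_real (V \<omega>)) \<partial>M) = - of_real (\<integral>\<omega>. U \<omega> * V \<omega> \<partial>M)" .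
    moreover have "(\<i> * a) * (\<i> * b) = - (a * b)" for a b :: complex
      by (simp add: complex_eq_iff)
    ultimately show ?thesis by simp
  qed
  also have "(\<integral>\<omega>. U \<omega> * V \<omega> \<partial>M) - (\<integral>\<omega>. U \<omega> \<partial>M) * (\<integral>\<omega>. V \<omega> \<partial>M) = covariance M U V"
    using intU intV intUV by (simp add: covariance_def algebra_simps prob_space)
  finally have lim: "(\<lambda>n. (\<integral>\<omega>. D n (U \<omega>) * D n (V \<omega>) \<partial>M) - (\<integral>\<omega>. D n (U \<omega>) \<partial>M) * (\<integral>\<omega>. D n (V \<omega>) \<partial>M))
     \<longlonglongrightarrow> - of_real (covariance M U V)" .
  have "((\<integral>\<omega>. cis (h n * U \<omega>) * cis (h n * V \<omega>) \<partial>M)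
        - (\<integral>\<omega>. cis (h n * U \<omega>) \<partial>M) * (\<integral>\<omega>. cis (h n * V \<omega>) \<partial>M)) / of_real ((h n)\<^sup>2)
      = (\<integral>\<omega>. D n (U \<omega>) * D n (V \<omega>) \<partial>M) - (\<integral>\<omega>. D n (U \<omega>) \<partial>M) * (\<integral>\<omega>. D n (V \<omega>) \<partial>M)" for n
  proof -
    define k where "k = complex_of_real (h n)"
    have k0: "k \<noteq> 0" using h0 by (simp add: k_def)
    have cis_D: "cis (h n * x) = 1 + k * D n x" for x
      using k0 by (simp add: D_def k_def)
    show ?thesis
      unfolding cis_D using k0 intD[of n]
      by (simp add: algebra_simps prob_space k_def [symmetric] power2_eq_square divide_simps)
  qed
  then show ?thesis using lim by simp
qed

text \<open>At time \<open>1\<close> the quotient of \<open>tendsto_covariance_cis\<close> is \<open>e * (exp w - 1) / h\<^sup>2\<close>, where \<open>w\<close> is the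
  difference of exponents and \<open>e\<close> tends to \<open>1\<close>. Because \<open>w\<close> tends to \<open>0\<close>, \<open>exp w - 1\<close> may be
  replaced by \<open>w\<close>.\<close>

lemma tendsto_cross_exponent:
  assumes U2: "integrable M (\<lambda>\<omega>. (comp1 X 1 \<omega>)\<^sup>2)" and V2: "integrable M (\<lambda>\<omega>. (comp2 X 1 \<omega>)\<^sup>2)"
    and h: "h \<longlonglongrightarrow> 0" and h0: "\<And>n. h n \<noteq> 0"
  shows "(\<lambda>n. (\<psi> (h n) (h n) - (\<psi>1 (h n) + \<psi>2 (h n))) / of_real ((h n)\<^sup>2))
      \<longlonglongrightarrow> - of_real (covariance M (comp1 X 1) (comp2 X 1))"
proof -
  let ?c = "covariance M (comp1 X 1) (comp2 X 1)"
  define w where "w n = \<psi> (h n) (h n) - (\<psi>1 (h n) + \<psi>2 (h n))" for n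
  define e where "e n = exp (\<psi>1 (h n) + \<psi>2 (h n))" for n
  have lim1: "(\<lambda>n. \<psi>1 (h n)) \<longlonglongrightarrow> 0" and lim2: "(\<lambda>n. \<psi>2 (h n)) \<longlonglongrightarrow> 0"
    and lim12: "(\<lambda>n. \<psi> (h n) (h n)) \<longlonglongrightarrow> 0"
    using tendsto_char_exponent_zero[OF h, of "(1, 0)"] tendsto_char_exponent_zero[OF h, of "(0, 1)"]
      tendsto_char_exponent_zero[OF h, of "(1, 1)"] by simp_all
  have "w \<longlonglongrightarrow> 0 - (0 + 0)"
    unfolding w_def by (intro tendsto_intros lim1 lim2 lim12)
  then have w0: "w \<longlonglongrightarrow> 0" by simp
  have "e \<longlonglongrightarrow> exp (0 + 0)"
    unfolding e_def by (intro tendsto_intros lim1 lim2)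
  then have e1: "e \<longlonglongrightarrow> 1" by simp
  have X1 [measurable]: "X 1 \<in> borel_measurable M"
    using X by (rule levy_process_measurable) simp
  have [measurable]: "comp1 X 1 \<in> borel_measurable M" "comp2 X 1 \<in> borel_measurable M"
    unfolding comp1_def comp2_def using X1 by (auto simp: borel_prod[symmetric])
  have char: "exp (\<psi> a b) = (\<integral>\<omega>. cis (a * comp1 X 1 \<omega>) * cis (b * comp2 X 1 \<omega>) \<partial>M)" for a b
    using process_char_eq_exp[OF X, of 1 "(a, b)"]
    by (simp add: process_char_def inner_prod_def comp1_def comp2_def cis_mult)
  have "(\<lambda>n. (exp (\<psi> (h n) (h n)) - exp (\<psi>1 (h n)) * exp (\<psi>2 (h n))) / of_real ((h n)\<^sup>2)) \<longlonglongrightarrow> - of_real ?c"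
    unfolding char by (simp del: of_real_power, rule tendsto_covariance_cis[OF _ _ U2 V2 h h0]) simp_all
  then have "(\<lambda>n. (e n * (exp (w n) - 1)) / of_real ((h n)\<^sup>2)) \<longlonglongrightarrow> - of_real ?c"
    by (simp add: e_def w_def exp_diff exp_add right_diff_distrib)
  then have "(\<lambda>n. (e n * (exp (w n) - 1)) / of_real ((h n)\<^sup>2) / e n) \<longlonglongrightarrow> - of_real ?c / 1"
    using e1 by (rule tendsto_divide) simp
  then have lim_exp: "(\<lambda>n. (exp (w n) - 1) / of_real ((h n)\<^sup>2)) \<longlonglongrightarrow> - of_real ?c"
    by (simp add: e_def)
  have q_lim: "(\<lambda>n. expm1_quotient (w n)) \<longlonglongrightarrow> 1"
    by (rule tendsto_expm1_quotient[OF w0])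
  have "(\<lambda>n. (exp (w n) - 1) / of_real ((h n)\<^sup>2) / expm1_quotient (w n)) \<longlonglongrightarrow> - of_real ?c / 1"
    using lim_exp q_lim by (rule tendsto_divide) simp
  moreover have "\<forall>\<^sub>F n in sequentially. (exp (w n) - 1) / of_real ((h n)\<^sup>2) / expm1_quotient (w n) = w n / of_real ((h n)\<^sup>2)"
  proof -
    have "\<forall>\<^sub>F n in sequentially. expm1_quotient (w n) \<noteq> 0"
      using q_lim by (rule tendsto_imp_eventually_ne) simp
    then show ?thesis
    proof eventually_elim
      case (elim n)
      have "exp (w n) - 1 = w n * expm1_quotient (w n)" by (rule expm1_quotient_mult)
      then show ?case using elim by simp
    qed
  qed
  ultimately show ?thesis
    unfolding w_def [symmetric] by (simp add: tendsto_cong)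
qed

lemma norm_exp_diff_le:
  fixes x y :: complex
  assumes "Re x \<le> 0" "Re y \<le> 0"
  shows "norm (exp x - exp y) \<le> norm (x - y)"
proof -
  have "norm (exp x - exp y) \<le> 1 * norm (x - y)"
  proof (rule field_differentiable_bound[where S = "{z. Re z \<le> 0}" and f = exp and f' = exp])
    show "convex {z. Re z \<le> 0}" by (rule convex_halfspace_Re_le)
    show "(exp has_field_derivative exp z) (at z within {z. Re z \<le> 0})" for z :: complex
      by (rule DERIV_subset[OF DERIV_exp]) simp
  qed (use assms in auto)
  then show ?thesis by simp
qed

text \<open>Divided by \<open>h\<^sup>2\<close>, the integrands of \<open>expectation_defect_eq_0\<close> at \<open>a = b = h\<close> converge to the overlap
  times minus the covariance. Domination by a multiple of the overlap uses that \<open>exp\<close> is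
  1-Lipschitz on the left half-plane, and the overlap is integrable because it is at most
  \<open>T\<^sub>1(s)\<close>.\<close>

lemma no_overlap_correlated_case:
  assumes st: "0 \<le> s" "s \<le> t"
    and T1: "integrable M (comp1 T s)"
    and U2: "integrable M (\<lambda>\<omega>. (comp1 X 1 \<omega>)\<^sup>2)" and V2: "integrable M (\<lambda>\<omega>. (comp2 X 1 \<omega>)\<^sup>2)"
    and cov: "covariance M (comp1 X 1) (comp2 X 1) \<noteq> 0"
  shows "AE \<omega> in M. shared_time s t \<omega> = 0"
proof -
  let ?c = "covariance M (comp1 X 1) (comp2 X 1)"
  define h where "h n = inverse (real (Suc n))" for n
  have h: "h \<longlonglongrightarrow> 0" unfolding h_def by (rule LIMSEQ_inverse_real_of_nat)
  have h0: "h n \<noteq> 0" for n by (simp add: h_def)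
  define w where "w n = \<psi> (h n) (h n) - (\<psi>1 (h n) + \<psi>2 (h n))" for n
  have w: "(\<lambda>n. w n / of_real ((h n)\<^sup>2)) \<longlonglongrightarrow> - of_real ?c"
    unfolding w_def by (rule tendsto_cross_exponent[OF U2 V2 h h0])
  then obtain B where B: "norm (w n / of_real ((h n)\<^sup>2)) \<le> B" for n
    using convergent_imp_Bseq[OF convergentI[OF w]] by (auto simp: Bseq_def)
  define F where "F n \<omega> = defect (h n) (h n) (shared_time s t \<omega>) * unshared_char (h n) (h n) s t \<omega> / of_real ((h n)\<^sup>2)" for n \<omega>
  have Lm: "shared_time s t \<in> borel_measurable M" using st by simp
  have intL: "integrable M (shared_time s t)"
  proof (rule Bochner_Integration.integrable_bound[OF T1 Lm])
    show "AE \<omega> in M. norm (shared_time s t \<omega>) \<le> norm (comp1 T s \<omega>)"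
      using AE_shared_time_bounds[OF st] by eventually_elim auto
  qed
  have F_int: "(\<integral>\<omega>. F n \<omega> \<partial>M) = 0" and F_meas: "F n \<in> borel_measurable M" for n
    using expectation_defect_eq_0[OF st, of "h n" "h n"] unfolding F_def by auto
  have lim_psi: "(\<lambda>n. \<psi>1 (h n)) \<longlonglongrightarrow> 0" "(\<lambda>n. \<psi>2 (h n)) \<longlonglongrightarrow> 0"
    and lim_psi12: "(\<lambda>n. \<psi> (h n) (h n)) \<longlonglongrightarrow> 0"
    using tendsto_char_exponent_zero[OF h, of "(1, 0)"] tendsto_char_exponent_zero[OF h, of "(0, 1)"]
      tendsto_char_exponent_zero[OF h, of "(1, 1)"] by simp_all
  have F_bound: "AE \<omega> in M. norm (F n \<omega>) \<le> B * shared_time s t \<omega>" for n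
    using AE_shared_time_bounds[OF st]
  proof eventually_elim
    case (elim \<omega>)
    have re: "Re (\<psi>1 (h n)) \<le> 0" "Re (\<psi>2 (h n)) \<le> 0" "Re (\<psi> (h n) (h n)) \<le> 0"
      by (rule Re_char_exponent_le[OF X])+
    have "norm (defect (h n) (h n) (shared_time s t \<omega>)) \<le> norm (of_real (shared_time s t \<omega>) * \<psi> (h n) (h n) - of_real (shared_time s t \<omega>) * (\<psi>1 (h n) + \<psi>2 (h n)))"
      unfolding defect_def using elim re by (intro norm_exp_diff_le) (simp_all add: mult_nonneg_nonpos)
    also have "\<dots> = shared_time s t \<omega> * norm (w n)"
      using elim by (simp add: w_def norm_mult flip: right_diff_distrib)
    finally have 1: "norm (defect (h n) (h n) (shared_time s t \<omega>)) \<le> shared_time s t \<omega> * norm (w n)" .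
    have 2: "norm (unshared_char (h n) (h n) s t \<omega>) \<le> 1"
      unfolding unshared_char_def exp_add norm_mult using elim
      by (intro mult_le_one norm_exp_exponent_le norm_ge_zero) auto
    have "norm (defect (h n) (h n) (shared_time s t \<omega>)) * norm (unshared_char (h n) (h n) s t \<omega>) \<le> (shared_time s t \<omega> * norm (w n)) * 1"
      using elim by (intro mult_mono 1 2 mult_nonneg_nonneg norm_ge_zero) auto
    then have "norm (F n \<omega>) \<le> (shared_time s t \<omega> * norm (w n)) * 1 / (h n)\<^sup>2"
      unfolding F_def norm_divide norm_mult norm_of_real by (simp add: divide_right_mono)
    also have "\<dots> = shared_time s t \<omega> * norm (w n / of_real ((h n)\<^sup>2))"
      by (simp add: norm_divide norm_power)
    also have "\<dots> \<le> shared_time s t \<omega> * B"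
      using B[of n] elim by (intro mult_left_mono) auto
    finally show ?case by (simp add: mult.commute)
  qed
  have F_lim: "(\<lambda>n. F n \<omega>) \<longlonglongrightarrow> - of_real (?c * shared_time s t \<omega>)" for \<omega>
  proof -
    define l where "l = shared_time s t \<omega>"
    let ?e = "\<lambda>n. exp (of_real l * (\<psi>1 (h n) + \<psi>2 (h n)))"
    have w0: "w \<longlonglongrightarrow> 0 - (0 + 0)"
      unfolding w_def by (intro tendsto_diff tendsto_add lim_psi lim_psi12)
    have e: "?e \<longlonglongrightarrow> exp (of_real l * (0 + 0))"
      by (intro tendsto_exp tendsto_mult tendsto_const tendsto_add lim_psi)
    have unshared_char: "(\<lambda>n. unshared_char (h n) (h n) s t \<omega>) \<longlonglongrightarrow>
        exp (of_real (comp1 T s \<omega> - shared_time s t \<omega>) * 0 + of_real (comp2 T t \<omega> - comp2 T s \<omega> - shared_time s t \<omega>) * 0)"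
      unfolding unshared_char_def by (intro tendsto_exp tendsto_mult tendsto_const tendsto_add lim_psi)
    have "(\<lambda>n. of_real l * w n) \<longlonglongrightarrow> of_real l * 0"
      using w0 by (intro tendsto_mult tendsto_const) simp
    then have q: "(\<lambda>n. expm1_quotient (of_real l * w n)) \<longlonglongrightarrow> 1"
      by (intro tendsto_expm1_quotient) simp
    have "F n \<omega> = ?e n * of_real l * (w n / of_real ((h n)\<^sup>2)) * expm1_quotient (of_real l * w n) * unshared_char (h n) (h n) s t \<omega>" for n
    proof -
      have "of_real l * \<psi> (h n) (h n) = of_real l * (\<psi>1 (h n) + \<psi>2 (h n)) + of_real l * w n"
        by (simp add: w_def algebra_simps)
      then have "defect (h n) (h n) l = ?e n * (exp (of_real l * w n) - 1)"
        by (simp only: defect_def exp_add right_diff_distrib mult_1_right)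
      then show ?thesis
        by (simp add: F_def expm1_quotient_mult flip: l_def)
    qed
    moreover have "(\<lambda>n. ?e n * of_real l * (w n / of_real ((h n)\<^sup>2)) * expm1_quotient (of_real l * w n) * unshared_char (h n) (h n) s t \<omega>)
        \<longlonglongrightarrow> exp (of_real l * (0 + 0)) * of_real l * - of_real ?c * 1
          * exp (of_real (comp1 T s \<omega> - shared_time s t \<omega>) * 0 + of_real (comp2 T t \<omega> - comp2 T s \<omega> - shared_time s t \<omega>) * 0)"
      by (intro tendsto_mult tendsto_const e q unshared_char w)
    ultimately show ?thesis by (simp add: l_def mult_ac)
  qed
  have "(\<lambda>n. \<integral>\<omega>. F n \<omega> \<partial>M) \<longlonglongrightarrow> (\<integral>\<omega>. - of_real (?c * shared_time s t \<omega>) \<partial>M)"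
    by (rule integral_dominated_convergence[where w = "\<lambda>\<omega>. B * shared_time s t \<omega>"])
      (use F_meas Lm intL F_bound F_lim in auto)
  then have "(\<integral>\<omega>. complex_of_real (?c * shared_time s t \<omega>) \<partial>M) = 0"
    unfolding F_int by (simp add: LIMSEQ_const_iff)
  then have "(\<integral>\<omega>. ?c * shared_time s t \<omega> \<partial>M) = 0"
    by (simp only: integral_complex_of_real of_real_eq_0_iff)
  then have "(\<integral>\<omega>. shared_time s t \<omega> \<partial>M) = 0" using cov by simp
  moreover have "AE \<omega> in M. 0 \<le> shared_time s t \<omega>"
    using AE_shared_time_bounds[OF st] by eventually_elim simp
  ultimately show ?thesis
    using integral_nonneg_eq_0_iff_AE[OF intL] by simp
qed

end

section \<open>Additive exponents make the components independent\<close>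

lemma (in prob_space) indep_var_if_generators:
  assumes U: "U \<in> measurable M N" and V: "V \<in> measurable M N'"
    and gen: "sets N = sigma_sets (space N) E" "sets N' = sigma_sets (space N') E'"
    and stable: "Int_stable E" "Int_stable E'"
    and prod: "\<And>A B. A \<in> E \<Longrightarrow> B \<in> E' \<Longrightarrow>
      prob ((U -` A \<inter> space M) \<inter> (V -` B \<inter> space M)) = prob (U -` A \<inter> space M) * prob (V -` B \<inter> space M)"
  shows "indep_var N U N' V"
proof -
  have sub: "E \<subseteq> sets N" "E' \<subseteq> sets N'"
    unfolding gen by (auto intro: sigma_sets.Basic)
  have preimage: "sigma_sets (space M) {W -` A \<inter> space M |A. A \<in> sets K} = sigma_sets (space M) {W -` A \<inter> space M |A. A \<in> G}"
    if "W \<in> measurable M K" "sets K = sigma_sets (space K) G" for W K G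
  proof -
    have "{W -` A \<inter> space M |A. A \<in> sets K} = sigma_sets (space M) {W -` A \<inter> space M |A. A \<in> G}"
      unfolding that(2) using measurable_space[OF that(1)] by (intro sigma_sets_vimage_commute) auto
    moreover have "{W -` A \<inter> space M |A. A \<in> G} \<subseteq> Pow (space M)" by auto
    ultimately show ?thesis by (simp only: sigma_sets_sigma_sets_eq)
  qed
  have Int_stable_vimage: "Int_stable {W -` A \<inter> space M |A. A \<in> G}" if "Int_stable G" for W :: "'a \<Rightarrow> 'x" and G
  proof (rule Int_stableI, safe)
    fix A B assume "A \<in> G" "B \<in> G"
    then have "A \<inter> B \<in> G" using that by (auto simp: Int_stable_def)
    then show "\<exists>C. (W -` A \<inter> space M) \<inter> (W -` B \<inter> space M) = W -` C \<inter> space M \<and> C \<in> G"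
      by (intro exI[of _ "A \<inter> B"]) auto
  qed
  show ?thesis
    unfolding indep_var_eq preimage[OF U gen(1)] preimage[OF V gen(2)]
  proof (intro conjI U V indep_set_sigma_sets Int_stable_vimage stable indep_setI)
    show "{U -` A \<inter> space M |A. A \<in> E} \<subseteq> events" "{V -` A \<inter> space M |A. A \<in> E'} \<subseteq> events"
      using sub measurable_sets[OF U] measurable_sets[OF V] by auto
  qed (use prod in auto)
qed

lemma indep_var_increments_if_exponent_additive:
  assumes X: "levy_process M X"
    and add: "\<And>a b. char_exponent M X (a, b) = char_exponent M X (a, 0) + char_exponent M X (0, b)"
    and st: "0 \<le> s" "s \<le> t"
  shows "prob_space.indep_var M borel (\<lambda>\<omega>. comp1 X t \<omega> - comp1 X s \<omega>) borel (\<lambda>\<omega>. comp2 X t \<omega> - comp2 X s \<omega>)"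
proof -
  interpret prob_space M by (rule levy_process_prob_space[OF X])
  have char: "(\<integral>\<omega>. cis (a * (comp1 X t \<omega> - comp1 X s \<omega>) + b * (comp2 X t \<omega> - comp2 X s \<omega>)) \<partial>M)
      = exp (of_real (t - s) * char_exponent M X (a, b))" for a b
  proof -
    have "(\<integral>\<omega>. cis (a * (comp1 X t \<omega> - comp1 X s \<omega>) + b * (comp2 X t \<omega> - comp2 X s \<omega>)) \<partial>M)
        = (\<integral>\<omega>. cis ((a, b) \<bullet> (X t \<omega> - X s \<omega>)) \<partial>M)"
      by (simp add: comp1_def comp2_def inner_prod_def)
    also have "\<dots> = (\<integral>\<omega>. cis ((a, b) \<bullet> X (t - s) \<omega>) \<partial>M)"
      by (rule levy_process_integral_increment[OF X st, where f = "\<lambda>x. cis (_ \<bullet> x)"]) simp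
    finally show ?thesis
      using process_char_eq_exp[OF X, of "t - s" "(a, b)"] st by (simp add: process_char_def)
  qed
  show ?thesis
  proof (rule indep_var_if_char_factors)
    fix a b
    show "(\<integral>\<omega>. cis (a * (comp1 X t \<omega> - comp1 X s \<omega>) + b * (comp2 X t \<omega> - comp2 X s \<omega>)) \<partial>M)
        = (\<integral>\<omega>. cis (a * (comp1 X t \<omega> - comp1 X s \<omega>)) \<partial>M) * (\<integral>\<omega>. cis (b * (comp2 X t \<omega> - comp2 X s \<omega>)) \<partial>M)"
      using char[of a b] char[of a 0] char[of 0 b] add[of a b]
      by (simp add: distrib_left exp_add)
  qed (use comp_borel_measurable[OF X] st in auto)
qed

text \<open>The pairs of increments are independent of each other, and the two entries of each pair are
  independent of one another; so probabilities of boxes factor completely.\<close>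

lemma indep_var_increment_vectors:
  fixes r :: "nat \<Rightarrow> real"
  assumes X: "levy_process M X"
    and add: "\<And>a b. char_exponent M X (a, b) = char_exponent M X (a, 0) + char_exponent M X (0, b)"
    and r: "0 \<le> r 0" "mono r" and n: "0 < n"
  shows "prob_space.indep_var M
    (PiM {..<n} (\<lambda>_. borel)) (\<lambda>\<omega>. \<lambda>i\<in>{..<n}. comp1 X (r (Suc i)) \<omega> - comp1 X (r i) \<omega>)
    (PiM {..<n} (\<lambda>_. borel)) (\<lambda>\<omega>. \<lambda>i\<in>{..<n}. comp2 X (r (Suc i)) \<omega> - comp2 X (r i) \<omega>)"
proof -
  interpret prob_space M by (rule levy_process_prob_space[OF X])
  have r0: "0 \<le> r i" for i using r monoD[OF r(2), of 0 i] by simp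
  have rS: "r i \<le> r (Suc i)" for i using r by (simp add: monoD)
  define D1 where "D1 i \<omega> = comp1 X (r (Suc i)) \<omega> - comp1 X (r i) \<omega>" for i \<omega>
  define D2 where "D2 i \<omega> = comp2 X (r (Suc i)) \<omega> - comp2 X (r i) \<omega>" for i \<omega>
  have D: "D1 i \<in> borel_measurable M" "D2 i \<in> borel_measurable M" for i
    unfolding D1_def [abs_def] D2_def [abs_def] using comp_borel_measurable[OF X r0] by auto
  have ind: "indep_vars (\<lambda>_. borel) (\<lambda>i \<omega>. X (r (Suc i)) \<omega> - X (r i) \<omega>) {..<n}"
    by (rule levy_process_indep[OF X]) (use r rS in auto)
  let ?G = "prod_algebra {..<n} (\<lambda>_. borel :: real measure)"
  have gen: "sets (PiM {..<n} (\<lambda>_. borel :: real measure)) = sigma_sets (space (PiM {..<n} (\<lambda>_. borel))) ?G"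
    by (simp only: sets_PiM space_PiM)
  note stable = Int_stable_prod_algebra[of "{..<n}" "\<lambda>_. borel :: real measure"]
  have box: "prob (((\<lambda>\<omega>. \<lambda>i\<in>{..<n}. D1 i \<omega>) -` PiE {..<n} A \<inter> space M) \<inter> ((\<lambda>\<omega>. \<lambda>i\<in>{..<n}. D2 i \<omega>) -` PiE {..<n} B \<inter> space M))
      = (\<Prod>i<n. prob (D1 i -` A i \<inter> space M)) * (\<Prod>i<n. prob (D2 i -` B i \<inter> space M))"
    if A: "\<And>i. i < n \<Longrightarrow> A i \<in> sets borel" and B: "\<And>i. i < n \<Longrightarrow> B i \<in> sets borel" for A B
  proof -
    have AB: "A i \<times> B i \<in> sets borel" if "i < n" for i
      using A[OF that] B[OF that] by (simp add: borel_prod[symmetric])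
    have eq: "(\<lambda>\<omega>. X (r (Suc i)) \<omega> - X (r i) \<omega>) -` (A i \<times> B i) \<inter> space M = (D1 i -` A i \<inter> space M) \<inter> (D2 i -` B i \<inter> space M)" for i
      by (auto simp: D1_def D2_def comp1_def comp2_def mem_Times_iff simp flip: fst_diff snd_diff)
    have "((\<lambda>\<omega>. \<lambda>i\<in>{..<n}. D1 i \<omega>) -` PiE {..<n} A \<inter> space M) \<inter> ((\<lambda>\<omega>. \<lambda>i\<in>{..<n}. D2 i \<omega>) -` PiE {..<n} B \<inter> space M)
        = (\<Inter>i\<in>{..<n}. (\<lambda>\<omega>. X (r (Suc i)) \<omega> - X (r i) \<omega>) -` (A i \<times> B i) \<inter> space M)"
      unfolding eq using n by (auto simp: PiE_iff)
    also have "prob \<dots> = (\<Prod>i<n. prob ((\<lambda>\<omega>. X (r (Suc i)) \<omega> - X (r i) \<omega>) -` (A i \<times> B i) \<inter> space M))"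
      using n AB by (intro indep_varsD_finite[OF ind]) auto
    also have "\<dots> = (\<Prod>i<n. prob (D1 i -` A i \<inter> space M) * prob (D2 i -` B i \<inter> space M))"
    proof (intro prod.cong refl)
      fix i assume "i \<in> {..<n}"
      then have "prob ((\<lambda>\<omega>. (D1 i \<omega>, D2 i \<omega>)) -` (A i \<times> B i) \<inter> space M) = prob (D1 i -` A i \<inter> space M) * prob (D2 i -` B i \<inter> space M)"
        using indep_varD[OF indep_var_increments_if_exponent_additive[OF X add r0 rS, of i], of "A i" "B i"] A B
        by (simp add: D1_def [abs_def] D2_def [abs_def])
      moreover have "(\<lambda>\<omega>. (D1 i \<omega>, D2 i \<omega>)) -` (A i \<times> B i) \<inter> space M = (D1 i -` A i \<inter> space M) \<inter> (D2 i -` B i \<inter> space M)"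
        by auto
      ultimately show "prob ((\<lambda>\<omega>. X (r (Suc i)) \<omega> - X (r i) \<omega>) -` (A i \<times> B i) \<inter> space M) = prob (D1 i -` A i \<inter> space M) * prob (D2 i -` B i \<inter> space M)"
        unfolding eq by simp
    qed
    finally show ?thesis by (simp add: prod.distrib)
  qed
  show ?thesis
    unfolding D1_def [symmetric] D2_def [symmetric]
  proof (rule indep_var_if_generators[OF _ _ gen gen stable stable])
    show "(\<lambda>\<omega>. \<lambda>i\<in>{..<n}. D1 i \<omega>) \<in> measurable M (PiM {..<n} (\<lambda>_. borel))"
      "(\<lambda>\<omega>. \<lambda>i\<in>{..<n}. D2 i \<omega>) \<in> measurable M (PiM {..<n} (\<lambda>_. borel))"
      using D by (auto intro: measurable_restrict)
    fix S S' assume S_in: "S \<in> ?G" "S' \<in> ?G"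
    obtain A where A': "S = PiE {..<n} A" "A \<in> (\<Pi> i\<in>{..<n}. sets borel)"
      using prod_algebraE_all[OF S_in(1)] by metis
    obtain B where B': "S' = PiE {..<n} B" "B \<in> (\<Pi> i\<in>{..<n}. sets borel)"
      using prod_algebraE_all[OF S_in(2)] by metis
    note S = A'(1) B'(1)
    have A: "\<And>i. i < n \<Longrightarrow> A i \<in> sets borel" and B: "\<And>i. i < n \<Longrightarrow> B i \<in> sets borel"
      using A'(2) B'(2) by auto
    have UN: "(UNIV :: real set) \<in> sets borel" by simp
    \<comment> \<open>The marginal probabilities are those of boxes whose other factor is the whole space.\<close>
    have full: "(\<lambda>\<omega>. \<lambda>i\<in>{..<n}. E i \<omega>) -` PiE {..<n} (\<lambda>_. UNIV) \<inter> space M = space M" for E :: "nat \<Rightarrow> 'a \<Rightarrow> real"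
      by (auto simp: PiE_iff)
    have "prob ((\<lambda>\<omega>. \<lambda>i\<in>{..<n}. D1 i \<omega>) -` S \<inter> space M) = (\<Prod>i<n. prob (D1 i -` A i \<inter> space M))"
      using box[OF A UN] unfolding full S by (simp add: prob_space Int_absorb2)
    moreover have "prob ((\<lambda>\<omega>. \<lambda>i\<in>{..<n}. D2 i \<omega>) -` S' \<inter> space M) = (\<Prod>i<n. prob (D2 i -` B i \<inter> space M))"
      using box[OF UN B] unfolding full S by (simp add: prob_space Int_absorb1)
    ultimately show "prob (((\<lambda>\<omega>. \<lambda>i\<in>{..<n}. D1 i \<omega>) -` S \<inter> space M) \<inter> ((\<lambda>\<omega>. \<lambda>i\<in>{..<n}. D2 i \<omega>) -` S' \<inter> space M))
      = prob ((\<lambda>\<omega>. \<lambda>i\<in>{..<n}. D1 i \<omega>) -` S \<inter> space M) * prob ((\<lambda>\<omega>. \<lambda>i\<in>{..<n}. D2 i \<omega>) -` S' \<inter> space M)"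
      unfolding S using box[OF A B] by simp
  qed
qed

text \<open>Lists the points of \<open>J\<close> together with \<open>0\<close> in increasing order and stays at the last one forever;
  the zero increments after the end spare a bound on the index.\<close>

lemma ex_mono_enumeration:
  fixes J :: "real set"
  assumes J: "finite J" "J \<subseteq> {0..}"
  obtains r :: "nat \<Rightarrow> real" and n where "r 0 = 0" "mono r" "0 < n" "J \<subseteq> r ` {..<n}" "\<And>i. 0 \<le> r i"
proof -
  define ts where "ts = sorted_list_of_set (insert 0 J)"
  have ts: "sorted ts" "set ts = insert 0 J" using J by (simp_all only: ts_def sorted_sorted_list_of_set set_sorted_list_of_set finite_insert)
  then have ne: "ts \<noteq> []" by auto
  define n where "n = length ts"
  define r where "r i = ts ! min i (n - 1)" for i
  have n: "0 < n" using ne by (simp add: n_def)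
  have "mono r"
    unfolding r_def using n by (intro monoI sorted_nth_mono[OF ts(1)]) (auto simp: n_def min_less_iff_disj)
  have r_in: "r i \<in> insert 0 J" for i
    unfolding ts(2)[symmetric] r_def using n by (intro nth_mem) (auto simp: n_def min_less_iff_disj)
  then have nonneg: "0 \<le> r i" for i using J(2) by (metis atLeast_iff insert_iff order_refl subset_iff)
  have img: "insert 0 J \<subseteq> r ` {..<n}"
  proof
    fix t assume "t \<in> insert 0 J"
    then obtain i where "i < n" "ts ! i = t" unfolding ts(2)[symmetric] by (metis in_set_conv_nth n_def)
    then show "t \<in> r ` {..<n}" by (auto simp: r_def intro!: image_eqI[of _ _ i])
  qed
  then obtain i where "r i = 0" by auto
  then have "r 0 = 0" using monoD[OF \<open>mono r\<close>, of 0 i] nonneg[of 0] by simp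
  then show ?thesis using that \<open>mono r\<close> n img nonneg by blast
qed

text \<open>The \<open>\<sigma>\<close>-algebra of the path space is generated by conditions on finitely many times. Up to
  the null event \<open>X 0 \<noteq> 0\<close>, such conditions on a component are conditions on the vector of its
  increments along a grid containing these times, whose partial sums recover the values.\<close>

lemma indep_comps_if_exponent_additive:
  assumes X: "levy_process M X"
    and add: "\<And>a b. char_exponent M X (a, b) = char_exponent M X (a, 0) + char_exponent M X (0, b)"
  shows "indep_processes M (comp1 X) (comp2 X)"
proof -
  interpret prob_space M by (rule levy_process_prob_space[OF X])
  have path: "path_of Z \<in> measurable M path_space" if "\<And>t. 0 \<le> t \<Longrightarrow> Z t \<in> borel_measurable M" for Z :: "real \<Rightarrow> 'a \<Rightarrow> real"
    unfolding path_of_def [abs_def] using that by (auto intro!: measurable_restrict)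
  show ?thesis
    unfolding indep_processes_def
  proof (rule indep_var_if_generators)
    show "path_of (comp1 X) \<in> measurable M path_space" "path_of (comp2 X) \<in> measurable M path_space"
      by (auto intro!: path comp_borel_measurable[OF X])
    show "sets path_space = sigma_sets (space path_space) (prod_algebra {0..} (\<lambda>_. borel :: real measure))"
      "sets path_space = sigma_sets (space path_space) (prod_algebra {0..} (\<lambda>_. borel :: real measure))"
      by (auto simp: sets_PiM space_PiM)
    show "Int_stable (prod_algebra {0..} (\<lambda>_. borel :: real measure))"
      "Int_stable (prod_algebra {0..} (\<lambda>_. borel :: real measure))"
      by (rule Int_stable_prod_algebra)+
    fix S1 S2 :: "(real \<Rightarrow> real) set" assume S: "S1 \<in> prod_algebra {0..} (\<lambda>_. borel :: real measure)" "S2 \<in> prod_algebra {0..} (\<lambda>_. borel :: real measure)"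
    from prod_algebraE[OF S(1)] obtain J1 :: "real set" and E1 :: "real \<Rightarrow> real set" where S1: "S1 = prod_emb {0..} (\<lambda>_. borel) J1 (PiE J1 E1)"
      "finite J1" "J1 \<subseteq> {0..}" "\<And>i. i \<in> J1 \<Longrightarrow> E1 i \<in> sets borel" by metis
    from prod_algebraE[OF S(2)] obtain J2 :: "real set" and E2 :: "real \<Rightarrow> real set" where S2: "S2 = prod_emb {0..} (\<lambda>_. borel) J2 (PiE J2 E2)"
      "finite J2" "J2 \<subseteq> {0..}" "\<And>i. i \<in> J2 \<Longrightarrow> E2 i \<in> sets borel" by metis
    obtain r :: "nat \<Rightarrow> real" and n where r: "r 0 = 0" "mono r" "0 < n" "J1 \<union> J2 \<subseteq> r ` {..<n}" "\<And>i. 0 \<le> r i"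
      using ex_mono_enumeration[of "J1 \<union> J2"] S1 S2 by auto
    have "\<forall>t\<in>J1 \<union> J2. \<exists>i. i < n \<and> r i = t"
    proof
      fix t assume "t \<in> J1 \<union> J2"
      then have "t \<in> r ` {..<n}" using r(4) by (rule subsetD[rotated])
      then show "\<exists>i. i < n \<and> r i = t" by (elim imageE) (simp, blast)
    qed
    from bchoice[OF this] obtain k where "\<forall>t\<in>J1 \<union> J2. k t < n \<and> r (k t) = t" ..
    then have k: "k t < n" "r (k t) = t" if "t \<in> J1 \<union> J2" for t
      using that by blast+
    let ?P = "PiM {..<n} (\<lambda>_. borel :: real measure)"
    define D where "D Z \<omega> = (\<lambda>i\<in>{..<n}. Z (r (Suc i)) \<omega> - Z (r i) \<omega>)" for Z :: "real \<Rightarrow> 'a \<Rightarrow> real" and \<omega>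
    define Q where "Q J E = {x \<in> space ?P. \<forall>t\<in>J. (\<Sum>i<k t. x i) \<in> E t}" for J :: "real set" and E
    have ind: "indep_var ?P (D (comp1 X)) ?P (D (comp2 X))"
      unfolding D_def [abs_def] by (rule indep_var_increment_vectors[OF X add]) (use r in auto)
    have Q_sets: "Q J E \<in> sets ?P" if "finite J" "J \<subseteq> J1 \<union> J2" "\<And>t. t \<in> J \<Longrightarrow> E t \<in> sets borel" for J E
    proof -
      have "{x \<in> space ?P. (\<Sum>i<k t. x i) \<in> E t} \<in> sets ?P" if "t \<in> J" for t
      proof -
        have "(\<lambda>x. \<Sum>i<k t. x i) \<in> borel_measurable ?P"
          using k(1)[of t] that \<open>J \<subseteq> J1 \<union> J2\<close>
          by (intro borel_measurable_sum measurable_component_singleton) auto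
        from measurable_sets[OF this] \<open>\<And>t. t \<in> J \<Longrightarrow> E t \<in> sets borel\<close>[OF that]
        have "(\<lambda>x. \<Sum>i<k t. x i) -` E t \<inter> space ?P \<in> sets ?P" .
        moreover have "{x \<in> space ?P. (\<Sum>i<k t. x i) \<in> E t} = (\<lambda>x. \<Sum>i<k t. x i) -` E t \<inter> space ?P"
          by auto
        ultimately show ?thesis by simp
      qed
      then show ?thesis unfolding Q_def using that(1) by (intro sets.sets_Collect_finite_All) auto
    qed
    have start: "AE \<omega> in M. comp1 X 0 \<omega> = 0 \<and> comp2 X 0 \<omega> = 0"
      using levy_process_start[OF X] by eventually_elim (simp add: comp1_def comp2_def)
    have path_iff: "path_of Z \<omega> \<in> prod_emb {0..} (\<lambda>_. borel) J (PiE J E) \<longleftrightarrow> D Z \<omega> \<in> Q J E"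
      if Z0: "Z 0 \<omega> = 0" and J: "J \<subseteq> J1 \<union> J2" "J \<subseteq> {0..}" for Z :: "real \<Rightarrow> 'a \<Rightarrow> real" and \<omega> J E
    proof -
      have "(\<Sum>i<k t. D Z \<omega> i) = Z t \<omega>" if "t \<in> J" for t
      proof -
        have kt: "k t < n" "r (k t) = t" using k[of t] that J by auto
        have "(\<Sum>i<k t. D Z \<omega> i) = (\<Sum>i<k t. Z (r (Suc i)) \<omega> - Z (r i) \<omega>)"
          using kt by (intro sum.cong) (auto simp: D_def)
        also have "\<dots> = Z t \<omega>" using sum_lessThan_telescope[of "\<lambda>i. Z (r i) \<omega>" "k t"] by (simp add: kt r Z0)
        finally show ?thesis .
      qed
      moreover have "D Z \<omega> \<in> space ?P" by (simp add: D_def space_PiM)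
      moreover have "path_of Z \<omega> \<in> prod_emb {0..} (\<lambda>_. borel) J (PiE J E) \<longleftrightarrow> (\<forall>t\<in>J. Z t \<omega> \<in> E t)"
        using J(2) by (auto simp: prod_emb_def path_of_def PiE_iff space_PiM)
      ultimately show ?thesis by (auto simp: Q_def)
    qed
    have Q12: "Q J1 E1 \<in> sets ?P" "Q J2 E2 \<in> sets ?P"
      using S1 S2 by (auto intro!: Q_sets)
    note rv = indep_var_rv1[OF ind] indep_var_rv2[OF ind]
    have S12: "S1 \<in> sets path_space" "S2 \<in> sets path_space"
      using S by (auto simp: sets_PiM intro: sigma_sets.Basic)
    have pathm: "path_of (comp1 X) \<in> measurable M path_space" "path_of (comp2 X) \<in> measurable M path_space"
      by (auto intro!: path comp_borel_measurable[OF X])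
    have AE1: "AE \<omega> in M. path_of (comp1 X) \<omega> \<in> S1 \<longleftrightarrow> D (comp1 X) \<omega> \<in> Q J1 E1"
      using start unfolding S1(1)
    proof eventually_elim
      case (elim \<omega>)
      then show ?case using S1(3) by (intro path_iff) auto
    qed
    have AE2: "AE \<omega> in M. path_of (comp2 X) \<omega> \<in> S2 \<longleftrightarrow> D (comp2 X) \<omega> \<in> Q J2 E2"
      using start unfolding S2(1)
    proof eventually_elim
      case (elim \<omega>)
      then show ?case using S2(3) by (intro path_iff) auto
    qed
    let ?A1 = "path_of (comp1 X) -` S1 \<inter> space M" and ?A2 = "path_of (comp2 X) -` S2 \<inter> space M"
    let ?B1 = "D (comp1 X) -` Q J1 E1 \<inter> space M" and ?B2 = "D (comp2 X) -` Q J2 E2 \<inter> space M"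
    have meas: "?A1 \<in> events" "?A2 \<in> events" "?B1 \<in> events" "?B2 \<in> events"
      using measurable_sets[OF pathm(1) S12(1)] measurable_sets[OF pathm(2) S12(2)]
        measurable_sets[OF rv(1) Q12(1)] measurable_sets[OF rv(2) Q12(2)] by auto
    have "prob ?A1 = prob ?B1"
      by (rule finite_measure_eq_AE[OF _ meas(1,3)]) (use AE1 in \<open>eventually_elim, simp\<close>)
    moreover have "prob ?A2 = prob ?B2"
      by (rule finite_measure_eq_AE[OF _ meas(2,4)]) (use AE2 in \<open>eventually_elim, simp\<close>)
    moreover have "prob (?A1 \<inter> ?A2) = prob (?B1 \<inter> ?B2)"
      by (rule finite_measure_eq_AE[OF _ sets.Int[OF meas(1,2)] sets.Int[OF meas(3,4)]])
        (use AE1 AE2 in \<open>eventually_elim, simp\<close>)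
    moreover have "prob (?B1 \<inter> ?B2) = prob ?B1 * prob ?B2"
    proof -
      have "(\<lambda>\<omega>. (D (comp1 X) \<omega>, D (comp2 X) \<omega>)) -` (Q J1 E1 \<times> Q J2 E2) \<inter> space M = ?B1 \<inter> ?B2" by auto
      then show ?thesis using indep_varD[OF ind Q12] by simp
    qed
    ultimately show "prob (?A1 \<inter> ?A2) = prob ?A1 * prob ?A2" by simp
  qed
qed

section \<open>Exchanging the two components, and the conclusion\<close>

definition swap_process :: "(real \<Rightarrow> 'a \<Rightarrow> real \<times> real) \<Rightarrow> real \<Rightarrow> 'a \<Rightarrow> real \<times> real" where
  "swap_process X t \<omega> = prod.swap (X t \<omega>)"

lemma comp_swap_process [simp]:
  "comp1 (swap_process X) = comp2 X" "comp2 (swap_process X) = comp1 X"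
  by (auto simp: fun_eq_iff comp1_def comp2_def swap_process_def)

lemma subordinate_swap_process:
  "subordinate (swap_process X) (swap_process T) = swap_process (subordinate X T)"
  by (auto simp: fun_eq_iff subordinate_def swap_process_def comp1_def comp2_def)

lemma borel_measurable_swap: "(prod.swap :: real \<times> real \<Rightarrow> _) \<in> borel_measurable borel"
  by (intro borel_measurable_continuous_onI continuous_on_swap)

lemma levy_process_swap_process:
  assumes X: "levy_process M X"
  shows "levy_process M (swap_process X)"
proof -
  interpret prob_space M by (rule levy_process_prob_space[OF X])
  have diff: "swap_process X t \<omega> - swap_process X s \<omega> = prod.swap (X t \<omega> - X s \<omega>)" for s t \<omega>
    by (simp add: swap_process_def prod_eq_iff)
  have distr_swap: "distr M borel (\<lambda>\<omega>. prod.swap (Z \<omega>)) = distr (distr M borel Z) borel prod.swap"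
    if "Z \<in> borel_measurable M" for Z :: "'a \<Rightarrow> real \<times> real"
    using that borel_measurable_swap by (subst distr_distr) (auto simp: o_def)
  have meas: "X t \<in> borel_measurable M" if "0 \<le> t" for t
    using X that by (rule levy_process_measurable)
  show ?thesis
    unfolding levy_process_def
  proof (intro conjI allI impI)
    show "swap_process X t \<in> borel_measurable M" if "0 \<le> t" for t
      unfolding swap_process_def [abs_def]
      by (rule measurable_compose[OF meas[OF that] borel_measurable_swap])
    show "AE \<omega> in M. swap_process X 0 \<omega> = 0"
      using levy_process_start[OF X] by eventually_elim (simp add: swap_process_def prod_eq_iff)
    show "indep_vars (\<lambda>_. borel) (\<lambda>i \<omega>. swap_process X (t (Suc i)) \<omega> - swap_process X (t i) \<omega>) {..<n}"
      if "0 \<le> t 0 \<and> (\<forall>i<n. t i \<le> t (Suc i))" for n and t :: "nat \<Rightarrow> real"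
      unfolding diff using that
      by (intro indep_vars_compose2[OF levy_process_indep[OF X]] borel_measurable_swap) auto
    show "distr M borel (\<lambda>\<omega>. swap_process X t \<omega> - swap_process X s \<omega>) = distr M borel (swap_process X (t - s))"
      if "0 \<le> s \<and> s \<le> t" for s t
    proof -
      have "distr M borel (\<lambda>\<omega>. swap_process X t \<omega> - swap_process X s \<omega>)
          = distr (distr M borel (\<lambda>\<omega>. X t \<omega> - X s \<omega>)) borel prod.swap"
        unfolding diff using that meas by (intro distr_swap borel_measurable_diff) auto
      also have "\<dots> = distr (distr M borel (X (t - s))) borel prod.swap"
        using that by (simp add: levy_process_stationary[OF X])
      also have "\<dots> = distr M borel (swap_process X (t - s))"
        unfolding swap_process_def [abs_def] using that meas by (intro distr_swap[symmetric]) auto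
      finally show ?thesis .
    qed
    show "AE \<omega> in M. cadlag (\<lambda>t. swap_process X t \<omega>)"
      using levy_process_cadlag[OF X]
    proof eventually_elim
      case (elim \<omega>)
      have lim: "((\<lambda>t. swap_process X t \<omega>) \<longlongrightarrow> prod.swap l) F" if "((\<lambda>t. X t \<omega>) \<longlongrightarrow> l) F" for l F
        unfolding swap_process_def prod.swap_def using that by (intro tendsto_intros)
      show ?case
        unfolding cadlag_def
      proof (intro conjI allI impI)
        show "((\<lambda>t. swap_process X t \<omega>) \<longlongrightarrow> swap_process X t \<omega>) (at_right t)" if "0 \<le> t" for t
          using lim[of "X t \<omega>" "at_right t"] elim that by (simp add: cadlag_def swap_process_def)
        show "\<exists>l. ((\<lambda>t. swap_process X t \<omega>) \<longlongrightarrow> l) (at_left t)" if "0 < t" for t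
          using lim[of _ "at_left t"] elim that unfolding cadlag_def by blast
      qed
    qed
  qed unfold_locales
qed

lemma bivariate_subordinator_swap_process:
  "bivariate_subordinator M T \<Longrightarrow> bivariate_subordinator M (swap_process T)"
  unfolding bivariate_subordinator_def
  by (auto simp: levy_process_swap_process swap_process_def)

lemma indep_processes_swap_process:
  assumes M: "prob_space M" and TX: "indep_processes M T X"
  shows "indep_processes M (swap_process T) (swap_process X)"
proof -
  interpret prob_space M by (rule M)
  define S where "S = (\<lambda>x :: real \<Rightarrow> real \<times> real. \<lambda>t\<in>{0..}. prod.swap (x t))"
  have S: "S \<in> measurable path_space path_space"
    unfolding S_def
    by (intro measurable_restrict measurable_compose[OF _ borel_measurable_swap])
      (rule measurable_component_singleton)
  have "S \<circ> path_of Z = path_of (swap_process Z)" for Z :: "real \<Rightarrow> 'a \<Rightarrow> real \<times> real"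
    by (auto simp: S_def path_of_def swap_process_def fun_eq_iff)
  then show ?thesis
    using indep_var_compose[OF TX[unfolded indep_processes_def] S S]
    by (simp add: indep_processes_def)
qed

lemma char_exponent_swap_process:
  "char_exponent M (swap_process X) (a, b) = char_exponent M X (b, a)"
  by (simp add: char_exponent_def process_char_def swap_process_def inner_prod_def add.commute)

text \<open>The characteristic function of a symmetric variable equals its complex conjugate, at every time;
  uniqueness of the exponent transfers this to the exponent.\<close>

lemma Im_char_exponent_if_symmetric:
  assumes X: "levy_process M X" and sym: "eq_in_law M X (\<lambda>t \<omega>. - X t \<omega>)"
  shows "Im (char_exponent M X u) = 0"
proof -
  interpret prob_space M by (rule levy_process_prob_space[OF X])
  have cnj: "exp (of_real t * char_exponent M X u) = exp (of_real t * cnj (char_exponent M X u))" if t: "0 \<le> t" for t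
  proof -
    have meas: "X r \<in> borel_measurable M" if "0 \<le> r" for r
      using X that by (rule levy_process_measurable)
    have path: "path_of X \<in> measurable M path_space" "path_of (\<lambda>t \<omega>. - X t \<omega>) \<in> measurable M path_space"
      unfolding path_of_def [abs_def] using meas by (auto intro!: measurable_restrict)
    have eval: "(\<lambda>x. cis (u \<bullet> x t)) \<in> borel_measurable path_space"
      using t by (intro measurable_compose[OF _ borel_measurable_cis] borel_measurable_inner
          measurable_component_singleton) auto
    have "(\<integral>\<omega>. cis (u \<bullet> path_of X \<omega> t) \<partial>M) = (\<integral>\<omega>. cis (u \<bullet> path_of (\<lambda>t \<omega>. - X t \<omega>) \<omega> t) \<partial>M)"
      using sym integral_distr[OF path(1) eval] integral_distr[OF path(2) eval] by (simp add: eq_in_law_def)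
    then have "(\<integral>\<omega>. cis (u \<bullet> X t \<omega>) \<partial>M) = (\<integral>\<omega>. cnj (cis (u \<bullet> X t \<omega>)) \<partial>M)"
      using t by (simp add: path_of_def cis_cnj)
    then have "process_char M X t u = cnj (process_char M X t u)"
      unfolding process_char_def by (rule trans) (rule Bochner_Integration.integral_cnj)
    then show ?thesis
      using process_char_eq_exp[OF X t, of u] by (simp add: exp_cnj)
  qed
  have "char_exponent M X u = cnj (char_exponent M X u)"
    by (rule exp_real_multiples_inject[OF cnj])
  then show ?thesis by (simp add: complex_eq_iff)
qed

context subordinated_levy
begin

text \<open>The existential in the first disjunct is the form in which dependence of the components enters.
  Exponents and moments are used here because they translate at once when the two components are
  exchanged, so that the lemma also yields the reverse inequality.\<close>

lemma comp1_le_comp2: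
  assumes nonnull: "\<not> indistinguishable M (comp2 T) (\<lambda>t \<omega>. 0)"
    and cases: "(\<exists>a b. \<psi> a b \<noteq> \<psi>1 a + \<psi>2 b) \<and> ((\<forall>u. Im (char_exponent M X u) = 0) \<or> deterministic_process M T)
      \<or> (\<forall>t\<ge>0. integrable M (comp1 T t)) \<and> integrable M (\<lambda>\<omega>. (comp1 X 1 \<omega>)\<^sup>2) \<and> integrable M (\<lambda>\<omega>. (comp2 X 1 \<omega>)\<^sup>2)
        \<and> covariance M (comp1 X 1) (comp2 X 1) \<noteq> 0"
    and s: "0 \<le> s"
  shows "AE \<omega> in M. comp1 T s \<omega> \<le> comp2 T s \<omega>"
proof -
  have "\<exists>t>s. AE \<omega> in M. shared_time s t \<omega> = 0"
    using cases
  proof (elim disjE conjE exE)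
    fix a b assume "\<psi> a b \<noteq> \<psi>1 a + \<psi>2 b" "\<forall>u. Im (char_exponent M X u) = 0"
    then have "AE \<omega> in M. shared_time s (s + 1) \<omega> = 0"
      using s by (intro no_overlap_symmetric_case[of s "s + 1" a b]) auto
    then show ?thesis by (intro exI[of _ "s + 1"]) simp
  next
    fix a b assume neq: "\<psi> a b \<noteq> \<psi>1 a + \<psi>2 b" and "deterministic_process M T"
    then obtain f where f: "AE \<omega> in M. \<forall>t\<ge>0. T t \<omega> = f t"
      by (auto simp: deterministic_process_def indistinguishable_def)
    define c where "c = norm (\<psi> a b - (\<psi>1 a + \<psi>2 b))"
    have c: "c > 0" using neq by (simp add: c_def)
    have "AE \<omega> in M. ((\<lambda>t. snd (f t) - snd (f s)) \<longlongrightarrow> 0) (at_right s)"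
      using f levy_process_cadlag[OF T_levy]
    proof eventually_elim
      case (elim \<omega>)
      then have "((\<lambda>t. T t \<omega>) \<longlongrightarrow> T s \<omega>) (at_right s)" using s by (simp add: cadlag_def)
      then have "((\<lambda>t. snd (T t \<omega>) - snd (T s \<omega>)) \<longlongrightarrow> snd (T s \<omega>) - snd (T s \<omega>)) (at_right s)"
        by (intro tendsto_intros)
      then have "((\<lambda>t. snd (T t \<omega>) - snd (T s \<omega>)) \<longlongrightarrow> 0) (at_right s)" by simp
      moreover have "\<forall>\<^sub>F t in at_right s. snd (T t \<omega>) - snd (T s \<omega>) = snd (f t) - snd (f s)"
        using eventually_at_right_less[of s] by eventually_elim (use elim s in auto)
      ultimately show ?case by (rule Lim_transform_eventually)
    qed
    then have lim: "((\<lambda>t. snd (f t) - snd (f s)) \<longlongrightarrow> 0) (at_right s)" by (simp add: AE_const)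
    have "\<forall>\<^sub>F t in at_right s. snd (f t) - snd (f s) < 2 * pi / c"
      using order_tendstoD(2)[OF lim, of "2 * pi / c"] c by simp
    then obtain d where d: "d > s" "\<And>t. s < t \<Longrightarrow> t < d \<Longrightarrow> snd (f t) - snd (f s) < 2 * pi / c"
      unfolding eventually_at_right_field by auto
    \<comment> \<open>Any time in \<open>(s, d)\<close> would do.\<close>
    define t where "t = (s + d) / 2"
    have t: "s < t" "t < d" using d(1) by (auto simp: t_def)
    have "AE \<omega> in M. shared_time s t \<omega> = 0"
    proof (rule no_overlap_deterministic_case[OF s _ _ _ neq])
      show "AE \<omega> in M. comp1 T s \<omega> = fst (f s) \<and> comp2 T s \<omega> = snd (f s) \<and> comp2 T t \<omega> = snd (f t)"
        using f by eventually_elim (use s t in \<open>auto simp: comp1_def comp2_def\<close>)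
      show "(snd (f t) - snd (f s)) * norm (\<psi> a b - (\<psi>1 a + \<psi>2 b)) < 2 * pi"
        using d(2)[OF t] c unfolding c_def [symmetric] by (simp add: pos_less_divide_eq)
    qed (use t in simp)
    then show ?thesis using t by auto
  next
    assume "\<forall>t\<ge>0. integrable M (comp1 T t)" "integrable M (\<lambda>\<omega>. (comp1 X 1 \<omega>)\<^sup>2)" "integrable M (\<lambda>\<omega>. (comp2 X 1 \<omega>)\<^sup>2)"
      "covariance M (comp1 X 1) (comp2 X 1) \<noteq> 0"
    then have "AE \<omega> in M. shared_time s (s + 1) \<omega> = 0"
      using s by (intro no_overlap_correlated_case) auto
    then show ?thesis by (intro exI[of _ "s + 1"]) simp
  qed
  then show ?thesis
    using comp1_le_comp2_if_no_overlap[OF s] nonnull by blast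
qed

lemma comps_indistinguishable_if_AE_eq:
  assumes eq: "\<And>s. 0 \<le> s \<Longrightarrow> AE \<omega> in M. comp1 T s \<omega> = comp2 T s \<omega>"
  shows "indistinguishable M (comp1 T) (comp2 T)"
proof -
  have "AE \<omega> in M. \<forall>q\<in>\<rat> \<inter> {0..}. comp1 T q \<omega> = comp2 T q \<omega>"
    using eq by (subst AE_ball_countable) (auto intro: countable_rat countable_Int1)
  then show ?thesis
    unfolding indistinguishable_def using levy_process_cadlag[OF T_levy]
  proof eventually_elim
    case (elim \<omega>)
    show ?case
    proof (intro allI impI)
      fix t :: real assume t: "0 \<le> t"
      have "\<exists>q. q \<in> \<rat> \<and> t < q \<and> q < t + 1 / real (Suc n)" for n
        using Rats_dense_in_real[of t "t + 1 / real (Suc n)"] by auto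
      then obtain q where q: "\<And>n. q n \<in> \<rat>" "\<And>n. t < q n" "\<And>n. q n < t + 1 / real (Suc n)" by metis
      have up: "(\<lambda>n. t + 1 / real (Suc n)) \<longlonglongrightarrow> t + 0"
        by (intro tendsto_add tendsto_const LIMSEQ_Suc[OF lim_1_over_n])
      have "q \<longlonglongrightarrow> t"
        using q by (intro tendsto_sandwich[OF _ _ tendsto_const up[simplified add_0_right]] always_eventually allI less_imp_le)
      then have "filterlim q (at_right t) sequentially"
        using q(2) less_imp_neq[OF q(2), symmetric] by (simp add: filterlim_at)
      then have lim: "(\<lambda>n. T (q n) \<omega>) \<longlonglongrightarrow> T t \<omega>"
        using elim t by (auto simp: cadlag_def intro: filterlim_compose)
      have "comp1 T (q n) \<omega> = comp2 T (q n) \<omega>" for n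
        using elim(1) q(1)[of n] q(2)[of n] t by auto
      then have "(\<lambda>n. comp1 T (q n) \<omega>) \<longlonglongrightarrow> comp2 T t \<omega>"
        using tendsto_snd[OF lim] by (simp add: comp2_def)
      moreover have "(\<lambda>n. comp1 T (q n) \<omega>) \<longlonglongrightarrow> comp1 T t \<omega>"
        using tendsto_fst[OF lim] by (simp add: comp1_def)
      ultimately show "comp1 T t \<omega> = comp2 T t \<omega>" by (rule LIMSEQ_unique[rotated])
    qed
  qed
qed

end

theorem proposition3p9:
  fixes M :: "'a measure" and T X :: "real \<Rightarrow> 'a \<Rightarrow> real \<times> real"
  assumes "prob_space M"
    and "levy_process M X"
    and "bivariate_subordinator M T"
    and "indep_processes M T X"
    and "\<not> indistinguishable M (comp1 T) (\<lambda>t \<omega>. 0)"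
    and "\<not> indistinguishable M (comp2 T) (\<lambda>t \<omega>. 0)"
    and "levy_process M (subordinate X T)"
    and "(eq_in_law M X (\<lambda>t \<omega>. - X t \<omega>) \<and> \<not> indep_processes M (comp1 X) (comp2 X))
       \<or> (deterministic_process M T \<and> \<not> indep_processes M (comp1 X) (comp2 X))
       \<or> (finite_moment M 1 T \<and> finite_moment M 2 X
          \<and> covariance M (comp1 X 1) (comp2 X 1) \<noteq> 0)"
  shows "indistinguishable M (comp1 T) (comp2 T)"
proof -
  interpret A: subordinated_levy M X T
    using assms by unfold_locales
  interpret B: subordinated_levy M "swap_process X" "swap_process T"
    using assms by unfold_locales
      (simp_all add: levy_process_swap_process bivariate_subordinator_swap_process
        indep_processes_swap_process subordinate_swap_process)
  let ?\<psi> = "char_exponent M X"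
  consider (exponent) a b where "?\<psi> (a, b) \<noteq> ?\<psi> (a, 0) + ?\<psi> (0, b)" "(\<forall>u. Im (?\<psi> u) = 0) \<or> deterministic_process M T"
    | (moments) "finite_moment M 1 T" "finite_moment M 2 X" "covariance M (comp1 X 1) (comp2 X 1) \<noteq> 0"
    using assms(8) indep_comps_if_exponent_additive[OF assms(2)] Im_char_exponent_if_symmetric[OF assms(2)]
    by blast
  then have "AE \<omega> in M. comp1 T s \<omega> = comp2 T s \<omega>" if s: "0 \<le> s" for s
  proof cases
    case exponent
    have "(\<forall>u. Im (char_exponent M (swap_process X) u) = 0) \<or> deterministic_process M (swap_process T)"
      using exponent(2)
    proof
      assume "\<forall>u. Im (?\<psi> u) = 0"
      then show ?thesis by (simp add: char_exponent_swap_process split_paired_All)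
    next
      assume "deterministic_process M T"
      then obtain f where "AE \<omega> in M. \<forall>t\<ge>0. T t \<omega> = f t"
        by (auto simp: deterministic_process_def indistinguishable_def)
      then have "AE \<omega> in M. \<forall>t\<ge>0. swap_process T t \<omega> = prod.swap (f t)"
        by eventually_elim (simp add: swap_process_def)
      then show ?thesis
        unfolding deterministic_process_def indistinguishable_def by (intro disjI2 exI[of _ "\<lambda>t. prod.swap (f t)"])
    qed
    moreover have "char_exponent M (swap_process X) (b, a) \<noteq> char_exponent M (swap_process X) (b, 0) + char_exponent M (swap_process X) (0, a)"
      using exponent(1) by (simp add: char_exponent_swap_process add.commute)
    ultimately have "AE \<omega> in M. comp2 T s \<omega> \<le> comp1 T s \<omega>"
      using B.comp1_le_comp2[OF _ _ s] assms(5) by auto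
    moreover have "AE \<omega> in M. comp1 T s \<omega> \<le> comp2 T s \<omega>"
      using A.comp1_le_comp2[OF _ _ s] assms(6) exponent by auto
    ultimately show ?thesis by eventually_elim simp
  next
    case moments
    have T1: "integrable M (comp1 T t)" "integrable M (comp2 T t)" if "0 \<le> t" for t
    proof -
      have "integrable M (\<lambda>\<omega>. norm (T t \<omega>))"
        using moments(1) that by (simp add: finite_moment_def)
      moreover have "norm (comp1 T t \<omega>) \<le> norm (norm (T t \<omega>))" "norm (comp2 T t \<omega>) \<le> norm (norm (T t \<omega>))" for \<omega>
        using norm_fst_le[of "fst (T t \<omega>)" "snd (T t \<omega>)"] norm_snd_le[of "snd (T t \<omega>)" "fst (T t \<omega>)"]
        by (simp_all add: comp1_def comp2_def)
      ultimately show "integrable M (comp1 T t)" "integrable M (comp2 T t)"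
        using A.comp_measurable[OF that] by (blast intro: Bochner_Integration.integrable_bound AE_I2)+
    qed
    have X2: "integrable M (\<lambda>\<omega>. (comp1 X 1 \<omega>)\<^sup>2)" "integrable M (\<lambda>\<omega>. (comp2 X 1 \<omega>)\<^sup>2)"
    proof -
      have int: "integrable M (\<lambda>\<omega>. norm (X 1 \<omega>) ^ 2)"
        using moments(2) by (simp add: finite_moment_def)
      have le: "norm ((fst x)\<^sup>2) \<le> norm (norm x ^ 2)" "norm ((snd x)\<^sup>2) \<le> norm (norm x ^ 2)" for x :: "real \<times> real"
        using power_mono[OF norm_fst_le[of "fst x" "snd x"], of 2] power_mono[OF norm_snd_le[of "snd x" "fst x"], of 2]
        by simp_all
      have meas: "(\<lambda>\<omega>. (comp1 X 1 \<omega>)\<^sup>2) \<in> borel_measurable M" "(\<lambda>\<omega>. (comp2 X 1 \<omega>)\<^sup>2) \<in> borel_measurable M"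
        using comp_borel_measurable[OF assms(2), of 1] by simp_all
      show "integrable M (\<lambda>\<omega>. (comp1 X 1 \<omega>)\<^sup>2)" "integrable M (\<lambda>\<omega>. (comp2 X 1 \<omega>)\<^sup>2)"
        using Bochner_Integration.integrable_bound[OF int meas(1)] Bochner_Integration.integrable_bound[OF int meas(2)] le
        by (simp_all only: comp1_def comp2_def AE_I2)
    qed
    have cov: "covariance M (comp2 X 1) (comp1 X 1) \<noteq> 0"
      using moments(3) by (simp add: covariance_def mult.commute)
    have "AE \<omega> in M. comp2 T s \<omega> \<le> comp1 T s \<omega>"
      using B.comp1_le_comp2[OF _ _ s] assms(5) T1 X2 cov by auto
    moreover have "AE \<omega> in M. comp1 T s \<omega> \<le> comp2 T s \<omega>"
      using A.comp1_le_comp2[OF _ _ s] assms(6) T1 X2 moments(3) by auto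
    ultimately show ?thesis by eventually_elim simp
  qed
  then show ?thesis by (rule A.comps_indistinguishable_if_AE_eq)
qed

end
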